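(* Let $\mathcal H=(V,E)$ be a connected hypergraph, and fix any ribbon structure on $\mathrm{Bip}\,\mathcal H$, base node $b_0$ and base edge $b_0b_1$. Then $\tilde I_{\mathcal H}=I_{\mathcal H}$. In particular $\tilde I_{\mathcal H}$ does not depend on the ribbon structure (nor on the base node and base edge).
   Context: A hypergraph is a pair $\mathcal H=(V,E)$ with $V$ a finite set and $E$ a finite multiset of nonempty subsets of $V$; $\mathrm{Bip}\,\mathcal H$ is the bipartite graph with color classes $V$ (violet) and $E$ (emerald), $v$ joined to $e$ iff $v\in e$; connected means $\mathrm{Bip}\,\mathcal H$ is connected. A hypertree on $E$ is $\mathbf f:E\to\mathbb Z_{\ge0}$ such that some spanning tree $T$ of $\mathrm{Bip}\,\mathcal H$ has $d_T(e)=\mathbf f(e)+1$ for all $e\in E$; $B_E$ is the set of hypertrees on $E$. Given a linear order on $E$, a hyperedge $e$ is internally active for $\mathbf f\in B_E$ if there is no $e'<e$ such that the vector obtained from $\mathbf f$ by decreasing its value at $e$ by $1$ and increasing its value at $e'$ by $1$ is a hypertree; otherwise $e$ is internally inactive, and $\bar\iota(\mathbf f)$ denotes the number of internally inactive hyperedges. The interior polynomial is $I_{\mathcal H}(\xi)=\sum_{\mathbf f\in B_E}\xi^{\bar\iota(\mathbf f)}$ for any fixed linear order on $E$ (it is known not to depend on the order). A ribbon structure on a loopless graph assigns to every node $x$ a cyclic permutation of its incident edges; $xy^+$ is the edge following $xy$ in the cyclic order at $x$; subgraphs inherit the restricted cyclic orders, $xy^+_G$ denoting the successor in subgraph $G$.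 The (ht:$E$, cut:$E$) Bernardi process on $\mathbf f\in B_E$: keep a current graph $G$ (initially $\mathrm{Bip}\,\mathcal H$) and current edge. If $b_0\in E$ the first current edge is $b_0b_1$; if $b_0\in V$ it is $b_1b_0^+$ and $b_0b_1$ counts as traversed from its violet endpoint. With current edge $ev$ ($e\in E$, $v\in V$): if $\mathbf f$ is still a hypertree on $E$ in $G-ev$, then $ev$ is removed, the current graph becomes $G-ev$ and the next current edge is $ev^+_G$; otherwise $ev$ is traversed from $e$, $vd:=ve^+_G$ is traversed from $v$, and the next current edge is $dv^+_G$. The process stops right before an edge would be traversed a second time from the same endpoint; every edge of $\mathrm{Bip}\,\mathcal H$ is current exactly once. For $\mathbf f\in B_E$, define the order $<_{\mathbf f}$ on $E$ by $e_1<_{\mathbf f}e_2$ iff some edge incident to $e_1$ becomes current earlier than every edge incident to $e_2$ in this process run on $\mathbf f$. Let $\overline{ie}(\mathbf f)$ be the number of internally inactive hyperedges for $\mathbf f$ with respect to $<_{\mathbf f}$, and $\tilde I_{\mathcal H}(\xi)=\sum_{\mathbf f\in B_E}\xi^{\overline{ie}(\mathbf f)}$. *)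

theory Defs
  imports
    "HOL-Library.FuncSet"
    "HOL-Combinatorics.Orbits"
    "HOL-Computational_Algebra.Polynomial"
begin

(* The multiset of hyperedges is a family: E is a finite set of hyperedge names and
   h e is the set of vertices of e, so h need not be injective on E. *)
definition hypergraph :: "'v set \<Rightarrow> 'e set \<Rightarrow> ('e \<Rightarrow> 'v set) \<Rightarrow> bool" where
  "hypergraph V E h \<longleftrightarrow> finite V \<and> finite E \<and> (\<forall>e\<in>E. h e \<noteq> {} \<and> h e \<subseteq> V)"

(* The nodes of Bip are V <+> E: a violet node is Inl v, an emerald node is Inr e.
   The pair (v, e) is the edge between them. Subgraphs keep all nodes, so a
   subgraph is identified with its set of edges. *)
definition Bip :: "'e set \<Rightarrow> ('e \<Rightarrow> 'v set) \<Rightarrow> ('v \<times> 'e) set" where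
  "Bip E h = {(v, e). e \<in> E \<and> v \<in> h e}"

definition adj :: "('v \<times> 'e) set \<Rightarrow> (('v + 'e) \<times> ('v + 'e)) set" where
  "adj G = (\<Union>(v, e)\<in>G. {(Inl v, Inr e), (Inr e, Inl v)})"

definition connected_graph :: "('v + 'e) set \<Rightarrow> ('v \<times> 'e) set \<Rightarrow> bool" where
  "connected_graph N G \<longleftrightarrow> (\<forall>x\<in>N. \<forall>y\<in>N. (x, y) \<in> (adj G)\<^sup>*)"

definition is_cycle :: "('v \<times> 'e) set \<Rightarrow> ('v + 'e) list \<Rightarrow> bool" where
  "is_cycle G xs \<longleftrightarrow> length xs \<ge> 3 \<and> distinct xs \<and>
     (\<forall>i<length xs. (xs ! i, xs ! (Suc i mod length xs)) \<in> adj G)"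

definition spanning_tree :: "('v + 'e) set \<Rightarrow> ('v \<times> 'e) set \<Rightarrow> ('v \<times> 'e) set \<Rightarrow> bool" where
  "spanning_tree N G T \<longleftrightarrow> T \<subseteq> G \<and> connected_graph N T \<and> (\<nexists>xs. is_cycle T xs)"

definition connected_hypergraph :: "'v set \<Rightarrow> 'e set \<Rightarrow> ('e \<Rightarrow> 'v set) \<Rightarrow> bool" where
  "connected_hypergraph V E h \<longleftrightarrow> hypergraph V E h \<and> connected_graph (V <+> E) (Bip E h)"

definition incident :: "('v \<times> 'e) set \<Rightarrow> 'v + 'e \<Rightarrow> ('v \<times> 'e) set" where
  "incident G x = {a \<in> G. x = Inl (fst a) \<or> x = Inr (snd a)}"

definition degree_in :: "('v \<times> 'e) set \<Rightarrow> 'v + 'e \<Rightarrow> nat" where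
  "degree_in G x = card (incident G x)"

(* Vectors on E are integer-valued, so that decreasing a value by 1 is not truncated. *)
definition hypertrees :: "'v set \<Rightarrow> 'e set \<Rightarrow> ('v \<times> 'e) set \<Rightarrow> ('e \<Rightarrow> int) set" where
  "hypertrees V E G = {f \<in> E \<rightarrow>\<^sub>E {0..}.
     \<exists>T. spanning_tree (V <+> E) G T \<and> (\<forall>e\<in>E. int (degree_in T (Inr e)) = f e + 1)}"

(* Here L is a strict order: (e', e) \<in> L means e' < e. *)
definition internally_active ::
  "'v set \<Rightarrow> 'e set \<Rightarrow> ('v \<times> 'e) set \<Rightarrow> ('e \<times> 'e) set \<Rightarrow> ('e \<Rightarrow> int) \<Rightarrow> 'e \<Rightarrow> bool" where
  "internally_active V E G L f e \<longleftrightarrow>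
     \<not> (\<exists>e'\<in>E. (e', e) \<in> L \<and> f(e := f e - 1, e' := f e' + 1) \<in> hypertrees V E G)"

definition internal_inactivity ::
  "'v set \<Rightarrow> 'e set \<Rightarrow> ('v \<times> 'e) set \<Rightarrow> ('e \<times> 'e) set \<Rightarrow> ('e \<Rightarrow> int) \<Rightarrow> nat" where
  "internal_inactivity V E G L f = card {e \<in> E. \<not> internally_active V E G L f e}"

definition interior_polynomial ::
  "'v set \<Rightarrow> 'e set \<Rightarrow> ('e \<Rightarrow> 'v set) \<Rightarrow> ('e \<times> 'e) set \<Rightarrow> int poly" where
  "interior_polynomial V E h r =
     (\<Sum>f\<in>hypertrees V E (Bip E h). monom 1 (internal_inactivity V E (Bip E h) (r - Id) f))"

definition ribbon_structure ::
  "('v + 'e) set \<Rightarrow> ('v \<times> 'e) set \<Rightarrow> ('v + 'e \<Rightarrow> 'v \<times> 'e \<Rightarrow> 'v \<times> 'e) \<Rightarrow> bool" where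
  "ribbon_structure N G \<rho> \<longleftrightarrow> (\<forall>x\<in>N. \<rho> x permutes incident G x \<and>
     (incident G x \<noteq> {} \<longrightarrow> cyclic_on (\<rho> x) (incident G x)))"

(* The edge following a in the cyclic order at x restricted to the subgraph G:
   the first edge of G among \<rho> x a, \<rho> x (\<rho> x a), ... It is a itself if a is the only
   edge of G at x. *)
definition succ_in ::
  "('v + 'e \<Rightarrow> 'v \<times> 'e \<Rightarrow> 'v \<times> 'e) \<Rightarrow> ('v \<times> 'e) set \<Rightarrow> 'v + 'e \<Rightarrow> 'v \<times> 'e \<Rightarrow> 'v \<times> 'e" where
  "succ_in \<rho> G x a = (\<rho> x ^^ (LEAST k. 0 < k \<and> (\<rho> x ^^ k) a \<in> G)) a"

(* A state of the process: the current graph, the current edge, and the traversals made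
   so far, where (x, a) records that a was traversed from its endpoint x. *)
type_synonym ('v, 'e) state = "('v \<times> 'e) set \<times> ('v \<times> 'e) \<times> (('v + 'e) \<times> ('v \<times> 'e)) set"

definition bernardi_init ::
  "('v \<times> 'e) set \<Rightarrow> ('v + 'e \<Rightarrow> 'v \<times> 'e \<Rightarrow> 'v \<times> 'e) \<Rightarrow> 'v + 'e \<Rightarrow> 'v \<times> 'e \<Rightarrow> ('v, 'e) state" where
  "bernardi_init G \<rho> b0 b = (case b0 of
       Inr e \<Rightarrow> (G, b, {})
     | Inl v \<Rightarrow> (G, succ_in \<rho> G (Inr (snd b)) b, {(Inl v, b)}))"

(* None means that the process stops: the next traversal would repeat an earlier one. *)
definition bernardi_step ::
  "'v set \<Rightarrow> 'e set \<Rightarrow> ('v + 'e \<Rightarrow> 'v \<times> 'e \<Rightarrow> 'v \<times> 'e) \<Rightarrow> ('e \<Rightarrow> int) \<Rightarrow>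
     ('v, 'e) state \<Rightarrow> ('v, 'e) state option" where
  "bernardi_step V E \<rho> f s = (case s of (G, a, R) \<Rightarrow>
     let x = Inl (fst a); y = Inr (snd a) in
     if f \<in> hypertrees V E (G - {a}) then Some (G - {a}, succ_in \<rho> G y a, R)
     else if (y, a) \<in> R then None
     else let c = succ_in \<rho> G x a in
       if (x, c) \<in> R then None
       else Some (G, succ_in \<rho> G (Inr (snd c)) c, R \<union> {(y, a), (x, c)}))"

fun bernardi_state ::
  "'v set \<Rightarrow> 'e set \<Rightarrow> ('v \<times> 'e) set \<Rightarrow> ('v + 'e \<Rightarrow> 'v \<times> 'e \<Rightarrow> 'v \<times> 'e) \<Rightarrow> 'v + 'e \<Rightarrow> 'v \<times> 'e \<Rightarrow>
     ('e \<Rightarrow> int) \<Rightarrow> nat \<Rightarrow> ('v, 'e) state option" where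
  "bernardi_state V E G \<rho> b0 b f 0 = Some (bernardi_init G \<rho> b0 b)"
| "bernardi_state V E G \<rho> b0 b f (Suc n) =
     Option.bind (bernardi_state V E G \<rho> b0 b f n) (bernardi_step V E \<rho> f)"

(* The edge a is current at time n. The process may stop because the next current edge
   has already been traversed from its emerald endpoint. That edge is not counted as
   current again, in line with every edge being current exactly once. *)
definition current_at ::
  "'v set \<Rightarrow> 'e set \<Rightarrow> ('v \<times> 'e) set \<Rightarrow> ('v + 'e \<Rightarrow> 'v \<times> 'e \<Rightarrow> 'v \<times> 'e) \<Rightarrow> 'v + 'e \<Rightarrow> 'v \<times> 'e \<Rightarrow>
     ('e \<Rightarrow> int) \<Rightarrow> nat \<Rightarrow> 'v \<times> 'e \<Rightarrow> bool" where
  "current_at V E G \<rho> b0 b f n a \<longleftrightarrow>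
     (\<exists>G' R. bernardi_state V E G \<rho> b0 b f n = Some (G', a, R) \<and> (Inr (snd a), a) \<notin> R)"

definition bernardi_order ::
  "'v set \<Rightarrow> 'e set \<Rightarrow> ('v \<times> 'e) set \<Rightarrow> ('v + 'e \<Rightarrow> 'v \<times> 'e \<Rightarrow> 'v \<times> 'e) \<Rightarrow> 'v + 'e \<Rightarrow> 'v \<times> 'e \<Rightarrow>
     ('e \<Rightarrow> int) \<Rightarrow> ('e \<times> 'e) set" where
  "bernardi_order V E G \<rho> b0 b f = {(e1, e2). e1 \<in> E \<and> e2 \<in> E \<and>
     (\<exists>n. \<exists>a\<in>incident G (Inr e1). current_at V E G \<rho> b0 b f n a \<and>
        (\<forall>m. \<forall>c\<in>incident G (Inr e2). current_at V E G \<rho> b0 b f m c \<longrightarrow> n < m))}"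

definition bernardi_polynomial ::
  "'v set \<Rightarrow> 'e set \<Rightarrow> ('e \<Rightarrow> 'v set) \<Rightarrow> ('v + 'e \<Rightarrow> 'v \<times> 'e \<Rightarrow> 'v \<times> 'e) \<Rightarrow> 'v + 'e \<Rightarrow> 'v \<times> 'e \<Rightarrow>
     int poly" where
  "bernardi_polynomial V E h \<rho> b0 b =
     (\<Sum>f\<in>hypertrees V E (Bip E h).
        monom 1 (internal_inactivity V E (Bip E h) (bernardi_order V E (Bip E h) \<rho> b0 b f) f))"

(* The base edge b0 b1 is given as the edge b, so b1 is the other endpoint of b. *)
definition bernardi_data ::
  "'v set \<Rightarrow> 'e set \<Rightarrow> ('e \<Rightarrow> 'v set) \<Rightarrow> ('v + 'e \<Rightarrow> 'v \<times> 'e \<Rightarrow> 'v \<times> 'e) \<Rightarrow> 'v + 'e \<Rightarrow> 'v \<times> 'e \<Rightarrow>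
     bool" where
  "bernardi_data V E h \<rho> b0 b \<longleftrightarrow>
     ribbon_structure (V <+> E) (Bip E h) \<rho> \<and> b0 \<in> V <+> E \<and> b \<in> incident (Bip E h) b0"

end

theory Submission
  imports Defs
begin

text \<open>By Rado's theorem a vector \<open>f\<close> is a hypertree iff \<open>\<Sum>e\<in>S. f e + 1\<close> is at most the graphic
  rank of the edges at \<open>S\<close> for all \<open>S \<subseteq> E\<close>, with equality for \<open>S = E\<close>. The tight sets of \<open>f\<close> are
  closed under union and intersection, and \<open>e'\<close> can receive from \<open>e\<close> iff every tight set containing
  \<open>e'\<close> contains \<open>e\<close>. Exchanging two consecutive hyperedges in the order therefore only matters for
  those \<open>f\<close> for which neither of them is reached from a smaller hyperedge, and there a bijection
  \<open>f \<mapsto> f - b + a\<close> compensates the change. All shifts involved avoid a tight set containing the smaller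
  hyperedges, so the argument remains valid for an order that depends on \<open>f\<close>, provided
  that such shifts do not alter its initial segment nor the next hyperedge.

  The Bernardi process has this property: removing edges at hyperedges of a tight set \<open>U\<close> destroys
  \<open>f\<close> iff it destroys its shifts outside \<open>U\<close>. That the process reaches every hyperedge follows
  from the fact that the current graph has no directed cycle that leaves each emerald node along a
  non-removable edge: the traversed edge sides form a closed face of the final graph, which is
  therefore closed under reversal and fills the whole graph.\<close>

section \<open>Spanned edges and rank\<close>

text \<open>The swap bijection pairs \<open>f\<close> with another hypertree, whose own order may a
  priori look different, so a sum with varying orders cannot be handled by swaps directly. The
  remedy is to work in classes of hypertrees that agree on an initial segment of their orders and
  that contain the partner of each member. Tight sets are preferred to realizing trees because a
  hypertree has many trees, none of them canonical, while tight sets can be united and intersected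
  and behave well under deletions. On the side of the process the obstacle is that the face walk
  lives in a graph that shrinks. Deleting an edge that has been traversed from its violet end would
  tear the walk. That this never happens is a fact about forced edges, and its proof follows faces
  both in the graph before and in the graph after the deletion.\<close>

definition edge_span :: "('v \<times> 'e) set \<Rightarrow> ('v \<times> 'e) set" where
  "edge_span F = {a. (Inl (fst a), Inr (snd a)) \<in> (adj F)\<^sup>*}"

definition edges_at :: "('v \<times> 'e) set \<Rightarrow> 'e set \<Rightarrow> ('v \<times> 'e) set" where
  "edges_at G S = {a \<in> G. snd a \<in> S}"

definition indep :: "('v \<times> 'e) set \<Rightarrow> bool" where
  "indep F \<longleftrightarrow> (\<forall>a\<in>F. a \<notin> edge_span (F - {a}))"

lemma adj_sym: "(x, y) \<in> adj F \<Longrightarrow> (y, x) \<in> adj F"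
  by (auto simp: adj_def)

lemma adj_iff:
  "(Inl v, Inr e) \<in> adj F \<longleftrightarrow> (v, e) \<in> F"
  "(Inr e, Inl v) \<in> adj F \<longleftrightarrow> (v, e) \<in> F"
  "(Inl v, Inl v') \<notin> adj F"
  "(Inr e, Inr e') \<notin> adj F"
  by (auto simp: adj_def)

lemma adjE:
  assumes "(x, y) \<in> adj F"
  obtains v e where "(v, e) \<in> F" "x = Inl v" "y = Inr e" | v e where "(v, e) \<in> F" "x = Inr e" "y = Inl v"
  using assms by (auto simp: adj_def)

lemma conn_sym: "(x, y) \<in> (adj F)\<^sup>* \<Longrightarrow> (y, x) \<in> (adj F)\<^sup>*"
  by (meson adj_sym symD symI sym_rtrancl)

lemma adj_mono: "F \<subseteq> F' \<Longrightarrow> adj F \<subseteq> adj F'"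
  by (auto simp: adj_def)

lemma conn_mono: "F \<subseteq> F' \<Longrightarrow> (adj F)\<^sup>* \<subseteq> (adj F')\<^sup>*"
  by (intro rtrancl_mono adj_mono)

lemma edge_span_superset: "F \<subseteq> edge_span F"
  by (auto simp: edge_span_def adj_iff intro!: r_into_rtrancl)

lemma conn_edge_span:
  assumes "X \<subseteq> edge_span F"
  shows "(adj X)\<^sup>* \<subseteq> (adj F)\<^sup>*"
proof -
  have "adj X \<subseteq> (adj F)\<^sup>*"
  proof clarify
    fix x y assume "(x, y) \<in> adj X"
    then show "(x, y) \<in> (adj F)\<^sup>*"
    proof (rule adjE)
      fix v e assume "(v, e) \<in> X" "x = Inl v" "y = Inr e"
      then show ?thesis using assms by (auto simp: edge_span_def)
    next
      fix v e assume "(v, e) \<in> X" "x = Inr e" "y = Inl v"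
      then show ?thesis using assms by (intro conn_sym[of y x]) (auto simp: edge_span_def)
    qed
  qed
  then show ?thesis
    by (rule rtrancl_subset_rtrancl)
qed

lemma edge_span_subset_edge_span: "X \<subseteq> edge_span F \<Longrightarrow> edge_span X \<subseteq> edge_span F"
  using conn_edge_span[of X F] by (auto simp: edge_span_def)

lemma edge_span_mono: "F \<subseteq> F' \<Longrightarrow> edge_span F \<subseteq> edge_span F'"
  using edge_span_superset edge_span_subset_edge_span by blast

lemma edges_at_simps [simp]:
  "a \<in> edges_at G S \<longleftrightarrow> a \<in> G \<and> snd a \<in> S"
  by (auto simp: edges_at_def)

lemma edges_at_Un: "edges_at G (S \<union> S') = edges_at G S \<union> edges_at G S'"
  and edges_at_Int: "edges_at G (S \<inter> S') = edges_at G S \<inter> edges_at G S'"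
  by auto

section \<open>Graphic rank on a fixed node set\<close>

locale bipartite_nodes =
  fixes V :: "'v set" and E :: "'e set"
  assumes finV: "finite V" and finE: "finite E" and V_nonempty: "V \<noteq> {}"
begin

definition component :: "('v \<times> 'e) set \<Rightarrow> 'v + 'e \<Rightarrow> ('v + 'e) set" where
  "component F x = (adj F)\<^sup>* `` {x}"

definition num_components :: "('v \<times> 'e) set \<Rightarrow> nat" where
  "num_components F = card (component F ` (V <+> E))"

text \<open>The rank function of the graphic matroid. Subgraphs keep all nodes, so isolated nodes
  count as components.\<close>

definition rank :: "('v \<times> 'e) set \<Rightarrow> int" where
  "rank F = int (card (V <+> E)) - int (num_components F)"

lemma component_eq_iff: "component F x = component F y \<longleftrightarrow> (x, y) \<in> (adj F)\<^sup>*"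
proof
  assume "component F x = component F y"
  then show "(x, y) \<in> (adj F)\<^sup>*" by (auto simp: component_def)
next
  assume a: "(x, y) \<in> (adj F)\<^sup>*"
  show "component F x = component F y"
    using a conn_sym[OF a] by (auto simp: component_def dest: rtrancl_trans)
qed

lemma finite_edges: "F \<subseteq> V \<times> E \<Longrightarrow> finite F"
  using finV finE finite_subset by blast

lemma rank_empty [simp]: "rank {} = 0"
proof -
  have "inj_on (component {}) (V <+> E)"
    by (auto simp: inj_on_def component_eq_iff adj_def)
  then show ?thesis by (simp add: rank_def num_components_def card_image)
qed

text \<open>A walk that uses the new edge repeatedly can be shortened to one that uses it at most
  once, in one of the two directions.\<close>

lemma conn_insert:
  "(adj (insert (v, e) F))\<^sup>* =
     (adj F)\<^sup>* \<union> {(x, y). (x, Inl v) \<in> (adj F)\<^sup>* \<and> (Inr e, y) \<in> (adj F)\<^sup>*}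
       \<union> {(x, y). (x, Inr e) \<in> (adj F)\<^sup>* \<and> (Inl v, y) \<in> (adj F)\<^sup>*}" (is "?L = ?R")
proof
  have sub: "(adj F)\<^sup>* \<subseteq> ?L" by (intro conn_mono) auto
  have "(Inl v, Inr e) \<in> ?L" "(Inr e, Inl v) \<in> ?L"
    by (auto simp: adj_iff intro!: r_into_rtrancl)
  then show "?R \<subseteq> ?L"
    using sub by (blast intro: rtrancl_trans)
  show "?L \<subseteq> ?R"
  proof clarify
    fix x y assume "(x, y) \<in> ?L" and n1: "\<not> ((x, Inr e) \<in> (adj F)\<^sup>* \<and> (Inl v, y) \<in> (adj F)\<^sup>*)"
      and "(x, y) \<notin> (adj F)\<^sup>*"
    then have "(x, y) \<in> ?R"
    proof (induction rule: rtrancl_induct)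
      case base then show ?case by simp
    next
      case (step y z)
      have "(y, z) \<in> adj F \<or> (y, z) = (Inl v, Inr e) \<or> (y, z) = (Inr e, Inl v)"
        using step(2) by (auto simp: adj_def)
      moreover have "(x, y) \<in> ?R"
        using step by blast
      ultimately show ?case
        by (auto intro: rtrancl_into_rtrancl rtrancl_trans dest: conn_sym)
    qed
    then show "(x, Inl v) \<in> (adj F)\<^sup>* \<and> (Inr e, y) \<in> (adj F)\<^sup>*"
      using n1 \<open>(x, y) \<notin> (adj F)\<^sup>*\<close> by blast
  qed
qed

text \<open>An edge between different components merges exactly these two. Monotonicity,
  submodularity and the effect of deletions are then obtained by adding edges one at a time.\<close>

lemma rank_insert:
  assumes "F \<subseteq> V \<times> E" "a \<in> V \<times> E"
  shows "rank (insert a F) = rank F + (if a \<in> edge_span F then 0 else 1)"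
proof -
  obtain v e where a: "a = (v, e)" "v \<in> V" "e \<in> E" using assms by auto
  let ?N = "V <+> E" and ?C = "component F" and ?C' = "component (insert a F)"
  let ?u = "Inl v" and ?w = "Inr e"
  have fin: "finite (?C ` ?N)" using finV finE by simp
  have uw: "?u \<in> ?N" "?w \<in> ?N" using a by auto
  show ?thesis
  proof (cases "a \<in> edge_span F")
    case True
    then have "insert a F \<subseteq> edge_span F" using edge_span_superset by auto
    then have "(adj (insert a F))\<^sup>* = (adj F)\<^sup>*"
      using conn_edge_span conn_mono by (metis set_eq_subset subset_insertI)
    then show ?thesis using True by (simp add: rank_def num_components_def component_def)
  next
    case False
    then have nc: "(?u, ?w) \<notin> (adj F)\<^sup>*" by (simp add: edge_span_def a)
    then have ne: "?C ?u \<noteq> ?C ?w" by (simp add: component_eq_iff)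
    have C': "?C' x = (if ?C x = ?C ?u \<or> ?C x = ?C ?w then ?C ?u \<union> ?C ?w else ?C x)" for x
    proof -
      have "?C' x = ?C x \<union> (if (x, ?u) \<in> (adj F)\<^sup>* then ?C ?w else {}) \<union>
          (if (x, ?w) \<in> (adj F)\<^sup>* then ?C ?u else {})"
        unfolding component_def a conn_insert by auto
      then show ?thesis
        by (auto simp: component_eq_iff[symmetric])
    qed
    have img: "?C' ` ?N = insert (?C ?u \<union> ?C ?w) (?C ` ?N - {?C ?u, ?C ?w})"
    proof (intro equalityI subsetI)
      fix K assume "K \<in> ?C' ` ?N"
      then show "K \<in> insert (?C ?u \<union> ?C ?w) (?C ` ?N - {?C ?u, ?C ?w})"
        by (auto simp: C')
    next
      fix K assume "K \<in> insert (?C ?u \<union> ?C ?w) (?C ` ?N - {?C ?u, ?C ?w})"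
      then consider "K = ?C ?u \<union> ?C ?w" | x where "x \<in> ?N" "K = ?C x" "?C x \<noteq> ?C ?u" "?C x \<noteq> ?C ?w"
        by blast
      then show "K \<in> ?C' ` ?N"
      proof cases
        case 1 then show ?thesis using uw C'[of ?u] by (metis (full_types) image_eqI)
      next
        case 2 then show ?thesis using C'[of x] by (metis (full_types) image_eqI)
      qed
    qed
    \<comment> \<open>An old component containing \<open>?u\<close> would be \<open>?C ?u\<close>,
      which has been taken out.\<close>
    have "?C ?u \<union> ?C ?w \<notin> ?C ` ?N - {?C ?u, ?C ?w}"
    proof
      assume "?C ?u \<union> ?C ?w \<in> ?C ` ?N - {?C ?u, ?C ?w}"
      then obtain x where "?C x = ?C ?u \<union> ?C ?w" "?C x \<noteq> ?C ?u" by auto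
      moreover have "?u \<in> ?C ?u" by (simp add: component_def)
      ultimately have "(x, ?u) \<in> (adj F)\<^sup>*" by (metis Image_singleton_iff UnI1 component_def)
      then show False using \<open>?C x \<noteq> ?C ?u\<close> by (simp add: component_eq_iff)
    qed
    then have "card (?C' ` ?N) = Suc (card (?C ` ?N - {?C ?u, ?C ?w}))"
      using fin img by simp
    moreover have "card (?C ` ?N - {?C ?u, ?C ?w}) = card (?C ` ?N) - 2"
      using ne uw by (subst card_Diff_subset) auto
    moreover have "card (?C ` ?N) \<ge> 2"
      using card_mono[OF fin, of "{?C ?u, ?C ?w}"] ne uw by auto
    ultimately show ?thesis
      using False by (simp add: rank_def num_components_def)
  qed
qed

lemma rank_mono:
  assumes "F \<subseteq> F'" "F' \<subseteq> V \<times> E"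
  shows "rank F \<le> rank F'"
proof -
  have "finite (F' - F)" using assms finite_edges by (meson finite_Diff)
  then have "\<And>F. F \<subseteq> V \<times> E \<Longrightarrow> X \<subseteq> V \<times> E \<Longrightarrow> rank F \<le> rank (F \<union> X)" if "X = F' - F" for X
    unfolding that[symmetric]
  proof (induction X)
    case (insert a X)
    then have "rank F \<le> rank (F \<union> X)" by blast
    also have "\<dots> \<le> rank (F \<union> insert a X)" using insert by (simp add: rank_insert)
    finally show ?case .
  qed simp
  then show ?thesis using assms by (metis Diff_partition Diff_subset subset_trans)
qed

lemma rank_le_card: "F \<subseteq> V \<times> E \<Longrightarrow> rank F \<le> int (card F)"
proof -
  assume "F \<subseteq> V \<times> E"
  then have "finite F" using finite_edges by blast
  then show ?thesis using \<open>F \<subseteq> V \<times> E\<close>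
  proof (induction F)
    case (insert a F)
    then show ?case by (auto simp: rank_insert)
  qed simp
qed

text \<open>Diminishing returns: what \<open>X \<union> Y\<close> spans is spanned by the larger
  \<open>F \<union> Y\<close>, so a new edge raises the rank over \<open>F\<close> by at most as
  much as over \<open>X\<close>.\<close>

lemma rank_submodular_aux:
  assumes "X \<subseteq> F" "F \<subseteq> V \<times> E" "Y \<subseteq> V \<times> E"
  shows "rank (F \<union> Y) + rank X \<le> rank F + rank (X \<union> Y)"
proof -
  have "finite Y" using assms finite_edges by blast
  then show ?thesis using assms(3)
  proof (induction Y)
    case (insert a Y)
    have "a \<in> edge_span (X \<union> Y) \<Longrightarrow> a \<in> edge_span (F \<union> Y)"
      using edge_span_mono[of "X \<union> Y" "F \<union> Y"] assms(1) by blast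
    moreover have "X \<union> Y \<subseteq> V \<times> E" "F \<union> Y \<subseteq> V \<times> E" "a \<in> V \<times> E"
      using insert assms by auto
    ultimately show ?case using insert by (auto simp: rank_insert)
  qed simp
qed

lemma rank_submodular:
  assumes "X \<subseteq> V \<times> E" "Y \<subseteq> V \<times> E"
  shows "rank (X \<union> Y) + rank (X \<inter> Y) \<le> rank X + rank Y"
proof -
  have "rank (X \<union> Y) + rank (X \<inter> Y) \<le> rank X + rank ((X \<inter> Y) \<union> Y)"
    by (rule rank_submodular_aux) (use assms in auto)
  then show ?thesis by (simp add: Un_absorb1)
qed

lemma rank_diff_bridge:
  assumes "F \<subseteq> V \<times> E" "a \<in> F"
  shows "rank F = rank (F - {a}) + (if a \<in> edge_span (F - {a}) then 0 else 1)"
proof -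
  have "F - {a} \<subseteq> V \<times> E" "a \<in> V \<times> E" using assms by auto
  then show ?thesis using rank_insert[of "F - {a}" a] assms(2) by (simp add: insert_absorb)
qed

text \<open>An edge of \<open>X\<close> not spanned by \<open>F\<close> would already raise the rank
  of \<open>F\<close> beyond that of \<open>X\<close>.\<close>

lemma rank_spans:
  assumes "F \<subseteq> X" "X \<subseteq> V \<times> E" "rank X \<le> rank F"
  shows "X \<subseteq> edge_span F"
proof
  fix a assume a: "a \<in> X"
  have "rank (insert a F) \<le> rank X" using a assms by (intro rank_mono) auto
  moreover have "F \<subseteq> V \<times> E" "a \<in> V \<times> E" using a assms by auto
  ultimately show "a \<in> edge_span F" using assms(3) rank_insert[of F a] by (auto split: if_splits)
qed

lemma rank_eq_if_spans:
  assumes "F \<subseteq> X" "X \<subseteq> V \<times> E" "X \<subseteq> edge_span F"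
  shows "rank X = rank F"
proof -
  have "(adj X)\<^sup>* = (adj F)\<^sup>*"
    using conn_edge_span[OF assms(3)] conn_mono[OF assms(1)] by auto
  then show ?thesis by (simp add: rank_def num_components_def component_def)
qed

lemma indep_rank:
  assumes "F \<subseteq> V \<times> E" "indep F"
  shows "rank F = int (card F)"
proof -
  have "finite F" using assms finite_edges by blast
  then show ?thesis using assms
  proof (induction F)
    case (insert a F)
    have "indep F" unfolding indep_def
    proof
      fix c assume c: "c \<in> F"
      then have "c \<notin> edge_span (insert a F - {c})" using insert.prems by (auto simp: indep_def)
      moreover have "edge_span (F - {c}) \<subseteq> edge_span (insert a F - {c})" by (intro edge_span_mono) auto
      ultimately show "c \<notin> edge_span (F - {c})" by auto
    qed
    moreover have "a \<notin> edge_span F"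
      using insert by (auto simp: indep_def)
    ultimately show ?case using insert by (simp add: rank_insert)
  qed simp
qed

lemma rank_indep:
  assumes "F \<subseteq> V \<times> E" "rank F \<ge> int (card F)"
  shows "indep F"
  unfolding indep_def
proof
  fix a assume a: "a \<in> F"
  have fin: "finite F" using finite_edges assms by blast
  have "rank (F - {a}) \<le> int (card (F - {a}))" using assms by (intro rank_le_card) auto
  moreover have "int (card (F - {a})) = int (card F) - 1"
    using a fin by (metis card_Suc_Diff1 add_diff_cancel_left' of_nat_Suc)
  ultimately show "a \<notin> edge_span (F - {a})"
    using rank_diff_bridge[OF assms(1) a] assms(2) by (auto split: if_splits)
qed

lemma indep_mono: "indep F \<Longrightarrow> F' \<subseteq> F \<Longrightarrow> indep F'"
  unfolding indep_def by (meson Diff_mono order_refl edge_span_mono subsetD)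

lemma connected_iff_rank:
  "connected_graph (V <+> E) F \<longleftrightarrow> rank F = int (card (V <+> E)) - 1"
proof -
  obtain z where z: "z \<in> V <+> E" using V_nonempty by auto
  have "connected_graph (V <+> E) F \<longleftrightarrow> (\<exists>K. component F ` (V <+> E) = {K})"
  proof
    assume "connected_graph (V <+> E) F"
    then have "\<forall>x\<in>V <+> E. component F x = component F z"
      using z by (simp add: connected_graph_def component_eq_iff)
    then have "component F ` (V <+> E) = {component F z}" using z by blast
    then show "\<exists>K. component F ` (V <+> E) = {K}" ..
  next
    assume "\<exists>K. component F ` (V <+> E) = {K}"
    then obtain K where "component F ` (V <+> E) = {K}" ..
    then have "component F x = K" if "x \<in> V <+> E" for x using that by blast
    then show "connected_graph (V <+> E) F"
      unfolding connected_graph_def component_eq_iff[symmetric] by simp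
  qed
  also have "\<dots> \<longleftrightarrow> num_components F = 1"
    by (simp add: num_components_def card_1_singleton_iff)
  finally show ?thesis by (auto simp: rank_def)
qed

lemma rank_le: "rank F \<le> int (card (V <+> E)) - 1"
proof -
  have "component F ` (V <+> E) \<noteq> {}" using V_nonempty by blast
  then have "num_components F \<noteq> 0" using finV finE by (simp add: num_components_def)
  then show ?thesis by (simp add: rank_def)
qed

end

section \<open>Simple paths, cycles and forests\<close>

lemma simple_path_ex:
  assumes "(x, y) \<in> r\<^sup>*"
  obtains xs where "distinct xs" "xs \<noteq> []" "hd xs = x" "last xs = y" "successively (\<lambda>a b. (a, b) \<in> r) xs"
proof -
  from assms have "\<exists>xs. distinct xs \<and> xs \<noteq> [] \<and> hd xs = x \<and> last xs = y \<and> successively (\<lambda>a b. (a, b) \<in> r) xs"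
  proof (induction rule: converse_rtrancl_induct)
    case base
    show ?case by (rule exI[of _ "[y]"]) simp
  next
    case (step x z)
    then obtain xs where xs: "distinct xs" "xs \<noteq> []" "hd xs = z" "last xs = y"
      "successively (\<lambda>a b. (a, b) \<in> r) xs" by blast
    show ?case
    proof (cases "x \<in> set xs")
      case True
      \<comment> \<open>Prepending \<open>x\<close> would repeat it, so the path is cut to start at
        its occurrence.\<close>
      then obtain us ws where "xs = us @ x # ws" by (auto simp: in_set_conv_decomp)
      then show ?thesis using xs
        by (intro exI[of _ "x # ws"]) (auto simp: successively_append_iff)
    next
      case False
      then show ?thesis using xs step(1)
        by (intro exI[of _ "x # xs"]) (auto simp: successively_Cons)
    qed
  qed
  then show ?thesis using that by blast
qed

lemma cyclic_list_of_path:
  assumes "successively (\<lambda>a b. (a, b) \<in> r) xs" "xs \<noteq> []" "(last xs, hd xs) \<in> r" "i < length xs"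
  shows "(xs ! i, xs ! (Suc i mod length xs)) \<in> r"
proof (cases "Suc i < length xs")
  case True
  then show ?thesis using assms(1) by (auto simp: successively_conv_nth)
next
  case False
  then have "Suc i = length xs" using assms by auto
  then have "i = length xs - 1" "Suc i mod length xs = 0" by auto
  then show ?thesis using assms(2,3) by (simp add: last_conv_nth hd_conv_nth)
qed

text \<open>Lets a cycle start at any of its nodes, as the extremal choice in
  \<open>no_forced_cycle\<close> requires.\<close>

lemma cyclic_list_rotate:
  assumes "\<forall>i<length xs. (xs ! i, xs ! (Suc i mod length xs)) \<in> r"
  shows "\<forall>i<length xs. (rotate k xs ! i, rotate k xs ! (Suc i mod length xs)) \<in> r"
proof clarify
  fix i assume i: "i < length xs"
  then have "0 < length xs" by auto
  then have "Suc ((k + i) mod length xs) mod length xs = (k + Suc i mod length xs) mod length xs"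
    by (metis add_Suc_right mod_Suc_eq mod_add_right_eq)
  moreover have "Suc i mod length xs < length xs" "(k + i) mod length xs < length xs"
    using \<open>0 < length xs\<close> by auto
  ultimately show "(rotate k xs ! i, rotate k xs ! (Suc i mod length xs)) \<in> r"
    using assms i by (metis nth_rotate)
qed

text \<open>Going round the cycle the other way avoids \<open>a\<close>, because with at least three
  distinct nodes no other step joins the same pair. The restriction to edges whose emerald end lies
  on the cycle serves \<open>no_forced_cycle\<close>.\<close>

lemma cycle_conn:
  assumes "distinct xs" "length xs \<ge> 3" "\<forall>i<length xs. (xs ! i, xs ! (Suc i mod length xs)) \<in> adj G"
    and "a \<in> G" "(xs ! 0, xs ! 1) \<in> adj {a}"
  shows "(xs ! 1, xs ! 0) \<in> (adj {c \<in> G - {a}. Inr (snd c) \<in> set xs})\<^sup>*"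
proof -
  let ?F = "{c \<in> G - {a}. Inr (snd c) \<in> set xs}" and ?n = "length xs"
  have edge: "(xs ! i, xs ! (Suc i mod ?n)) \<in> adj ?F" if "1 \<le> i" "i < ?n" for i
  proof -
    have m: "Suc i mod ?n = (if Suc i = ?n then 0 else Suc i)" using that by auto
    then have m': "Suc i mod ?n < ?n" using that by auto
    have "(xs ! i, xs ! (Suc i mod ?n)) \<in> adj G" using assms that by blast
    moreover have "xs ! i \<in> set xs" "xs ! (Suc i mod ?n) \<in> set xs" using that m' by auto
    moreover have "(xs ! i, xs ! (Suc i mod ?n)) \<notin> adj {a}"
    proof
      assume "(xs ! i, xs ! (Suc i mod ?n)) \<in> adj {a}"
      then have "{xs ! i, xs ! (Suc i mod ?n)} = {xs ! 0, xs ! 1}"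
        using assms(5) by (auto simp: adj_def)
      then have e: "xs ! i = xs ! 0 \<or> xs ! i = xs ! 1"
        "xs ! (Suc i mod ?n) = xs ! 0 \<or> xs ! (Suc i mod ?n) = xs ! 1"
        by (auto simp: doubleton_eq_iff)
      have "0 < ?n" "1 < ?n" using assms(2) by auto
      then have "i = 1" using e(1) nth_eq_iff_index_eq[OF assms(1) \<open>i < ?n\<close>] that(1) by fastforce
      then have "Suc i mod ?n = 2" using assms(2) by simp
      then show False
        using e(2) assms(2) nth_eq_iff_index_eq[OF assms(1), of 2] \<open>0 < ?n\<close> \<open>1 < ?n\<close> by fastforce
    qed
    ultimately show ?thesis by (auto simp: adj_def)
  qed
  have "(xs ! 1, xs ! k) \<in> (adj ?F)\<^sup>*" if "1 \<le> k" "k < ?n" for k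
    using that
  proof (induction k rule: dec_induct)
    case (step k)
    then have "(xs ! k, xs ! (Suc k mod ?n)) \<in> adj ?F" using edge[of k] by simp
    moreover have "Suc k mod ?n = Suc k" using step by simp
    ultimately show ?case using step by (auto intro: rtrancl_into_rtrancl)
  qed simp
  then have "(xs ! 1, xs ! (?n - 1)) \<in> (adj ?F)\<^sup>*" using assms(2) by simp
  moreover have "(xs ! (?n - 1), xs ! 0) \<in> adj ?F"
  proof -
    have n: "1 \<le> ?n - 1" "?n - 1 < ?n" "Suc (?n - 1) = ?n" using assms(2) by auto
    show ?thesis using edge[OF n(1,2)] unfolding n(3) mod_self .
  qed
  ultimately show ?thesis by (rule rtrancl_into_rtrancl)
qed

text \<open>Translates the cycle-based definition of a spanning tree into matroid language. An edge
  spanned by the others closes a simple path to a cycle; the path has at least three nodes since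
  there are no parallel edges.\<close>

lemma acyclic_iff_indep:
  "(\<nexists>xs. is_cycle T xs) \<longleftrightarrow> indep T"
proof -
  have "\<exists>xs. is_cycle T xs" if "a \<in> T" "a \<in> edge_span (T - {a})" for a
  proof -
    have "(Inl (fst a), Inr (snd a)) \<in> (adj (T - {a}))\<^sup>*" using that by (simp add: edge_span_def)
    then obtain xs where xs: "distinct xs" "xs \<noteq> []" "hd xs = Inl (fst a)" "last xs = Inr (snd a)"
      "successively (\<lambda>x y. (x, y) \<in> adj (T - {a})) xs" by (rule simple_path_ex)
    have "length xs \<ge> 3"
    proof (rule ccontr)
      assume "\<not> ?thesis"
      then consider "length xs = 0" | "length xs = 1" | "length xs = 2" by linarith
      then show False
      proof cases
        case 3
        then obtain p q where "xs = [p, q]" by (metis (no_types, lifting) One_nat_def Suc_1 length_0_conv length_Suc_conv)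
        then show ?thesis using xs by (auto simp: adj_iff)
      qed (use xs in \<open>auto simp: length_Suc_conv\<close>)
    qed
    moreover have "successively (\<lambda>x y. (x, y) \<in> adj T) xs"
      using xs(5) adj_mono[of "T - {a}" T] by (auto elim!: successively_mono)
    moreover have "(last xs, hd xs) \<in> adj T"
      using xs that by (simp add: adj_iff)
    ultimately have "is_cycle T xs"
      using xs cyclic_list_of_path[of "adj T" xs] by (auto simp: is_cycle_def)
    then show ?thesis ..
  qed
  moreover have "\<exists>a\<in>T. a \<in> edge_span (T - {a})" if "is_cycle T xs" for xs
  proof -
    have xs: "distinct xs" "length xs \<ge> 3" "\<forall>i<length xs. (xs ! i, xs ! (Suc i mod length xs)) \<in> adj T"
      using that by (auto simp: is_cycle_def)
    have "0 < length xs" "Suc 0 mod length xs = 1" using xs by auto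
    then have "(xs ! 0, xs ! 1) \<in> adj T" using xs(3) by metis
    then obtain a where a: "a \<in> T" "(xs ! 0, xs ! 1) \<in> adj {a}" by (auto simp: adj_def)
    have "(xs ! 1, xs ! 0) \<in> (adj {c \<in> T - {a}. Inr (snd c) \<in> set xs})\<^sup>*"
      using cycle_conn[OF xs a] .
    then have "(xs ! 1, xs ! 0) \<in> (adj (T - {a}))\<^sup>*"
      using conn_mono[of "{c \<in> T - {a}. Inr (snd c) \<in> set xs}" "T - {a}"] by blast
    then have "a \<in> edge_span (T - {a})"
      using a(2) conn_sym by (auto simp: edge_span_def adj_def)
    then show ?thesis using a by blast
  qed
  ultimately show ?thesis unfolding indep_def
    by blast
qed

section \<open>Hypertrees as integer points\<close>

context bipartite_nodes
begin

text \<open>\<open>f e + 1\<close> is the prescribed degree of \<open>e\<close>, so this is the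
  number of edges at \<open>S\<close> in any realizing tree.\<close>

definition weight :: "('e \<Rightarrow> int) \<Rightarrow> 'e set \<Rightarrow> int" where
  "weight f S = (\<Sum>e\<in>S. f e + 1)"

definition tight :: "('v \<times> 'e) set \<Rightarrow> ('e \<Rightarrow> int) \<Rightarrow> 'e set \<Rightarrow> bool" where
  "tight G f U \<longleftrightarrow> U \<subseteq> E \<and> weight f U = rank (edges_at G U)"

definition rank_bounded :: "('v \<times> 'e) set \<Rightarrow> ('e \<Rightarrow> int) \<Rightarrow> bool" where
  "rank_bounded G f \<longleftrightarrow> (\<forall>S\<subseteq>E. weight f S \<le> rank (edges_at G S))"

lemma edges_at_subset: "G \<subseteq> V \<times> E \<Longrightarrow> edges_at G S \<subseteq> V \<times> E"
  by auto

lemma finite_subE: "S \<subseteq> E \<Longrightarrow> finite S"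
  using finE finite_subset by blast

lemma weight_Un_Int:
  assumes "S \<subseteq> E" "S' \<subseteq> E"
  shows "weight f (S \<union> S') + weight f (S \<inter> S') = weight f S + weight f S'"
  unfolding weight_def using sum.union_inter[of S S' "\<lambda>e. f e + 1"] assms finite_subE by simp

lemma weight_insert: "S \<subseteq> E \<Longrightarrow> e \<notin> S \<Longrightarrow> weight f (insert e S) = f e + 1 + weight f S"
  unfolding weight_def using finite_subE by simp

text \<open>Uncrossing: the weight is modular and the rank submodular, so neither of the
  inequalities at the union and the intersection can be strict.\<close>

lemma tight_Un_Int:
  assumes "G \<subseteq> V \<times> E" "rank_bounded G f" "tight G f S" "tight G f S'"
  shows "tight G f (S \<union> S')" "tight G f (S \<inter> S')"
proof -
  have sub: "S \<subseteq> E" "S' \<subseteq> E" using assms by (auto simp: tight_def)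
  then have "weight f (S \<union> S') \<le> rank (edges_at G (S \<union> S'))" "weight f (S \<inter> S') \<le> rank (edges_at G (S \<inter> S'))"
    using assms(2) by (simp_all add: rank_bounded_def le_infI1)
  moreover have "rank (edges_at G (S \<union> S')) + rank (edges_at G (S \<inter> S')) \<le> rank (edges_at G S) + rank (edges_at G S')"
    using rank_submodular[of "edges_at G S" "edges_at G S'"] edges_at_subset[OF assms(1)] by (simp add: edges_at_Un edges_at_Int)
  ultimately show "tight G f (S \<union> S')" "tight G f (S \<inter> S')"
    using assms(3,4) weight_Un_Int[OF sub, of f] sub by (auto simp: tight_def)
qed

lemma tight_Inter:
  assumes "G \<subseteq> V \<times> E" "rank_bounded G f" "finite \<U>" "\<U> \<noteq> {}" "\<And>U. U \<in> \<U> \<Longrightarrow> tight G f U"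
  shows "tight G f (\<Inter>\<U>)"
  using assms(3-5)
proof (induction \<U> rule: finite_ne_induct)
  case (insert U \<U>)
  then show ?case using tight_Un_Int(2)[OF assms(1,2), of U "\<Inter>\<U>"] by simp
qed simp

lemma tight_Union:
  assumes "G \<subseteq> V \<times> E" "rank_bounded G f" "finite \<U>" "\<And>U. U \<in> \<U> \<Longrightarrow> tight G f U"
  shows "tight G f (\<Union>\<U>)"
  using assms(3,4)
proof (induction \<U>)
  case empty
  show ?case by (simp add: tight_def weight_def edges_at_def)
next
  case (insert U \<U>)
  then show ?case using tight_Un_Int(1)[OF assms(1,2), of U "\<Union>\<U>"] by simp
qed

text \<open>Deleting \<open>a\<close> lowers a rank by at most one. By integrality a set violated
  afterwards was tight before, and \<open>a\<close> is a bridge of the edges at it.\<close>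

lemma tight_bridge_of_violation:
  assumes G: "G \<subseteq> V \<times> E" and b: "rank_bounded G f" and a: "a \<in> G" and n: "\<not> rank_bounded (G - {a}) f"
  obtains U where "tight G f U" "snd a \<in> U" "a \<notin> edge_span (edges_at G U - {a})"
proof -
  obtain S where S: "S \<subseteq> E" "weight f S > rank (edges_at (G - {a}) S)"
    using n by (auto simp: rank_bounded_def not_le)
  have d: "edges_at (G - {a}) S = edges_at G S - {a}" by auto
  have le: "weight f S \<le> rank (edges_at G S)" using b S by (auto simp: rank_bounded_def)
  have "a \<in> edges_at G S"
  proof (rule ccontr)
    assume "a \<notin> edges_at G S"
    then show False using S le d by simp
  qed
  then have "rank (edges_at G S) = rank (edges_at G S - {a}) + (if a \<in> edge_span (edges_at G S - {a}) then 0 else 1)"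
    by (intro rank_diff_bridge edges_at_subset G)
  then have "a \<notin> edge_span (edges_at G S - {a})" "tight G f S"
    using S le d by (auto simp: tight_def split: if_splits)
  then show ?thesis using that \<open>a \<in> edges_at G S\<close> by auto
qed

section \<open>Rado's theorem for hypertrees\<close>

lemma rank_bridges:
  assumes "X \<subseteq> F" "F \<subseteq> V \<times> E" "\<And>a. a \<in> X \<Longrightarrow> a \<notin> edge_span (F - {a})"
  shows "rank F = rank (F - X) + int (card X)"
proof -
  have "finite X" using assms finite_edges by (meson finite_subset subset_trans)
  then show ?thesis using assms(1,3)
  proof (induction X)
    case (insert a X)
    have "a \<notin> edge_span (F - {a})" using insert by blast
    then have "a \<notin> edge_span (F - insert a X)" using edge_span_mono[of "F - insert a X" "F - {a}"] by blast
    moreover have "insert a (F - insert a X) = F - X" using insert by auto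
    moreover have "F - insert a X \<subseteq> V \<times> E" "a \<in> V \<times> E" using insert assms by auto
    ultimately have "rank (F - X) = rank (F - insert a X) + 1"
      using rank_insert[of "F - insert a X" a] by simp
    then show ?case using insert by simp
  qed simp
qed

text \<open>Rado's argument: if every edge at \<open>e\<close> were needed, then all of them would be bridges of the
  subgraph of a single tight set, and its rank would be too large.\<close>
lemma deletable_edge:
  assumes G: "G \<subseteq> V \<times> E" and b: "rank_bounded G f" and e: "e \<in> E"
    and d: "int (card (edges_at G {e})) > f e + 1"
    and ne: "edges_at G {e} \<noteq> {}"
  shows "\<exists>a\<in>edges_at G {e}. rank_bounded (G - {a}) f"
proof (rule ccontr)
  assume all: "\<not> ?thesis"
  have "\<exists>U. tight G f U \<and> snd a \<in> U \<and> a \<notin> edge_span (edges_at G U - {a})" if "a \<in> edges_at G {e}" for a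
    using tight_bridge_of_violation[OF G b, of a] that all by (metis edges_at_simps)
  then obtain U where U: "\<And>a. a \<in> edges_at G {e} \<Longrightarrow> tight G f (U a) \<and> snd a \<in> U a \<and> a \<notin> edge_span (edges_at G (U a) - {a})"
    by metis
  define S where "S = \<Inter>(U ` edges_at G {e})"
  have "finite (edges_at G {e})" using finite_edges edges_at_subset[OF G] by blast
  then have t: "tight G f S" unfolding S_def using U ne by (intro tight_Inter[OF G b]) auto
  have eS: "e \<in> S" using U by (fastforce simp: S_def)
  have "rank (edges_at G S) = rank (edges_at G S - edges_at G {e}) + int (card (edges_at G {e}))"
  proof (rule rank_bridges)
    show "edges_at G {e} \<subseteq> edges_at G S" using eS by auto
    fix a assume a: "a \<in> edges_at G {e}"
    have "edges_at G S \<subseteq> edges_at G (U a)" using a by (auto simp: S_def)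
    then show "a \<notin> edge_span (edges_at G S - {a})"
      using U[OF a] edge_span_mono[of "edges_at G S - {a}" "edges_at G (U a) - {a}"] by blast
  qed (use edges_at_subset[OF G] in auto)
  moreover have "edges_at G S - edges_at G {e} = edges_at G (S - {e})" by auto
  moreover have "weight f (S - {e}) \<le> rank (edges_at G (S - {e}))"
    using b t unfolding rank_bounded_def tight_def by (meson Diff_subset subset_trans)
  moreover have "weight f S = f e + 1 + weight f (S - {e})"
    using weight_insert[of "S - {e}" e f] eS t by (auto simp: insert_absorb tight_def)
  ultimately show False using d t by (simp add: tight_def)
qed

text \<open>Greedy deletion: as long as some degree exceeds \<open>f e + 1\<close>,
  \<open>deletable_edge\<close> supplies an edge whose loss keeps all inequalities. The inequality
  for singletons shows that no degree is too small.\<close>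

lemma rado:
  assumes "G \<subseteq> V \<times> E" "rank_bounded G f" "\<And>e. e \<in> E \<Longrightarrow> f e + 1 \<ge> 0"
  obtains T where "T \<subseteq> G" "rank_bounded T f" "\<And>e. e \<in> E \<Longrightarrow> int (card (edges_at T {e})) = f e + 1"
proof -
  have "finite G" using assms finite_edges by blast
  then have "\<exists>T\<subseteq>G. rank_bounded T f \<and> (\<forall>e\<in>E. int (card (edges_at T {e})) = f e + 1)"
    using assms(1,2)
  proof (induction G rule: finite_psubset_induct)
    case (psubset G)
    show ?case
    proof (cases "\<forall>e\<in>E. int (card (edges_at G {e})) = f e + 1")
      case True
      then show ?thesis using psubset by blast
    next
      case False
      then obtain e where e: "e \<in> E" "int (card (edges_at G {e})) \<noteq> f e + 1" by blast
      have "weight f {e} \<le> rank (edges_at G {e})" using psubset e by (auto simp: rank_bounded_def)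
      also have "\<dots> \<le> int (card (edges_at G {e}))" by (intro rank_le_card edges_at_subset psubset)
      finally have "int (card (edges_at G {e})) > f e + 1" using e by (simp add: weight_def)
      moreover have "edges_at G {e} \<noteq> {}"
        using calculation assms(3)[OF e(1)] by auto
      ultimately obtain a where a: "a \<in> edges_at G {e}" "rank_bounded (G - {a}) f"
        using deletable_edge[OF psubset.prems e(1)] by blast
      have "G - {a} \<subset> G" "G - {a} \<subseteq> V \<times> E" using a psubset by auto
      then show ?thesis using psubset.IH a(2) by (meson subset_trans psubset_imp_subset)
    qed
  qed
  then show ?thesis using that by blast
qed

lemma degree_in_eq: "degree_in T (Inr e) = card (edges_at T {e})"
proof -
  have "incident T (Inr e) = edges_at T {e}" by (auto simp: incident_def)
  then show ?thesis by (simp add: degree_in_def)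
qed

lemma weight_eq_card:
  assumes "T \<subseteq> V \<times> E" "\<And>e. e \<in> E \<Longrightarrow> int (card (edges_at T {e})) = f e + 1" "S \<subseteq> E"
  shows "weight f S = int (card (edges_at T S))"
proof -
  have fin: "finite (edges_at T X)" for X using finite_edges edges_at_subset[OF assms(1)] by blast
  have "edges_at T S = (\<Union>e\<in>S. edges_at T {e})" by auto
  then have "card (edges_at T S) = (\<Sum>e\<in>S. card (edges_at T {e}))"
    using fin finite_subE[OF assms(3)] by (subst card_UN_disjoint[symmetric]) auto
  then show ?thesis unfolding weight_def using assms(2,3) by (simp add: subset_iff)
qed

text \<open>A realizing tree without reference to a host graph, so that the same \<open>T\<close>
  can be used in several subgraphs.\<close>

definition realizes :: "('v \<times> 'e) set \<Rightarrow> ('e \<Rightarrow> int) \<Rightarrow> bool" where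
  "realizes T f \<longleftrightarrow> T \<subseteq> V \<times> E \<and> indep T \<and> connected_graph (V <+> E) T \<and>
     (\<forall>e\<in>E. int (card (edges_at T {e})) = f e + 1)"

lemma hypertrees_realizes:
  assumes "G \<subseteq> V \<times> E"
  shows "f \<in> hypertrees V E G \<longleftrightarrow> f \<in> E \<rightarrow>\<^sub>E {0..} \<and> (\<exists>T\<subseteq>G. realizes T f)"
proof -
  have "spanning_tree (V <+> E) G T \<and> (\<forall>e\<in>E. int (degree_in T (Inr e)) = f e + 1)
    \<longleftrightarrow> T \<subseteq> G \<and> realizes T f" for T
    unfolding spanning_tree_def acyclic_iff_indep degree_in_eq realizes_def using assms by auto
  then show ?thesis unfolding hypertrees_def by auto
qed

lemma realizes_indep_weight:
  assumes "realizes T f" "S \<subseteq> E"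
  shows "weight f S = rank (edges_at T S)"
proof -
  have "edges_at T S \<subseteq> T" by auto
  then have "edges_at T S \<subseteq> V \<times> E" "indep (edges_at T S)"
    using assms(1) indep_mono[of T "edges_at T S"] unfolding realizes_def by blast+
  then show ?thesis using indep_rank assms weight_eq_card[of T f S] by (simp add: realizes_def)
qed

lemma connected_adj_ex:
  assumes c: "connected_graph (V <+> E) T" and x: "x \<in> V <+> E" "y \<in> V <+> E" "x \<noteq> y"
  shows "\<exists>z. (x, z) \<in> adj T"
proof -
  have "(x, y) \<in> (adj T)\<^sup>*" using c x by (simp add: connected_graph_def)
  then show ?thesis using \<open>x \<noteq> y\<close> by (metis converse_rtranclE)
qed

text \<open>For the converse, the edge set found by \<open>rado\<close> has as many edges as a
  spanning tree, and its own rank bound makes it independent and of full rank. Nonnegativity of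
  \<open>f\<close> is a consequence of the connectedness of this tree.\<close>

lemma hypertrees_iff_rank:
  assumes G: "G \<subseteq> V \<times> E"
  shows "f \<in> hypertrees V E G \<longleftrightarrow>
    f \<in> extensional E \<and> rank_bounded G f \<and> weight f E = int (card (V <+> E)) - 1"
proof
  assume "f \<in> hypertrees V E G"
  then obtain T where f: "f \<in> E \<rightarrow>\<^sub>E {0..}" and T: "T \<subseteq> G" "realizes T f"
    using hypertrees_realizes[OF G] by auto
  have "weight f S \<le> rank (edges_at G S)" if "S \<subseteq> E" for S
  proof -
    have "weight f S = rank (edges_at T S)" using realizes_indep_weight T that by blast
    also have "\<dots> \<le> rank (edges_at G S)" using T G by (intro rank_mono) auto
    finally show ?thesis .
  qed
  moreover have "weight f E = int (card (V <+> E)) - 1"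
  proof -
    have "edges_at T E = T" using T by (auto simp: realizes_def)
    then have "weight f E = rank T" using realizes_indep_weight[OF T(2), of E] by simp
    then show ?thesis using connected_iff_rank[of T] T by (simp add: realizes_def)
  qed
  ultimately show "f \<in> extensional E \<and> rank_bounded G f \<and> weight f E = int (card (V <+> E)) - 1"
    using f by (auto simp: rank_bounded_def PiE_iff)
next
  assume R: "f \<in> extensional E \<and> rank_bounded G f \<and> weight f E = int (card (V <+> E)) - 1"
  have dE: "edges_at F E = F" if "F \<subseteq> V \<times> E" for F using that by auto
  \<comment> \<open>The total weight equals the upper bound on all ranks, so the weight of
    \<open>E - {e}\<close> cannot exceed it.\<close>
  have "f e + 1 \<ge> 0" if e: "e \<in> E" for e
  proof -
    have "rank (edges_at G (E - {e})) \<le> int (card (V <+> E)) - 1" by (rule rank_le)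
    moreover have "weight f (E - {e}) \<le> rank (edges_at G (E - {e}))" using R by (auto simp: rank_bounded_def)
    moreover have "weight f E = f e + 1 + weight f (E - {e})" using weight_insert[of "E - {e}" e f] e by (auto simp: insert_absorb)
    ultimately show ?thesis using R by linarith
  qed
  then obtain T where T: "T \<subseteq> G" "rank_bounded T f" "\<And>e. e \<in> E \<Longrightarrow> int (card (edges_at T {e})) = f e + 1"
    using rado[OF G, of f] R by blast
  have TV: "T \<subseteq> V \<times> E" using T G by auto
  have "int (card T) = weight f E" using weight_eq_card[OF TV T(3), of E] dE[OF TV] by simp
  moreover have "weight f E \<le> rank T" using T(2) dE[OF TV] by (auto simp: rank_bounded_def)
  ultimately have "indep T" "rank T = int (card (V <+> E)) - 1"
    using rank_indep[OF TV] rank_le[of T] R by auto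
  then have r: "realizes T f" using T(3) TV connected_iff_rank by (auto simp: realizes_def)
  have "f e \<ge> 0" if e: "e \<in> E" for e
  proof -
    obtain v where "v \<in> V" using V_nonempty by auto
    then obtain z where "(Inr e, z) \<in> adj T" using connected_adj_ex[of T "Inr e" "Inl v"] r e by (auto simp: realizes_def)
    then have "edges_at T {e} \<noteq> {}" by (auto simp: adj_def edges_at_def)
    moreover have "finite (edges_at T {e})" using finite_edges edges_at_subset[OF TV] by blast
    ultimately have "card (edges_at T {e}) > 0" by (simp add: card_gt_0_iff)
    then show ?thesis using T(3)[OF e] by linarith
  qed
  then have "f \<in> E \<rightarrow>\<^sub>E {0..}" using R by (auto simp: PiE_iff)
  then show "f \<in> hypertrees V E G" using r T(1) hypertrees_realizes[OF G] by blast
qed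

end

section \<open>Exchanges and tight sets\<close>

context bipartite_nodes
begin

text \<open>The receiver \<open>y\<close> comes first, the donor \<open>x\<close> second. Phrased by
  tight sets the relation is a preorder, reflexive even where a shift makes no sense.\<close>

definition exchangeable :: "('v \<times> 'e) set \<Rightarrow> ('e \<Rightarrow> int) \<Rightarrow> 'e \<Rightarrow> 'e \<Rightarrow> bool" where
  "exchangeable G f y x \<longleftrightarrow> (\<forall>U. tight G f U \<longrightarrow> y \<in> U \<longrightarrow> x \<in> U)"

definition shift :: "('e \<Rightarrow> int) \<Rightarrow> 'e \<Rightarrow> 'e \<Rightarrow> 'e \<Rightarrow> int" where
  "shift f x y = f(x := f x - 1, y := f y + 1)"

lemma weight_shift:
  assumes "S \<subseteq> E" "x \<noteq> y"
  shows "weight (shift f x y) S = weight f S + (if y \<in> S then 1 else 0) - (if x \<in> S then 1 else 0)"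
proof -
  have fin: "finite S" using assms finite_subE by blast
  have "weight (shift f x y) S = (\<Sum>e\<in>S. (f e + 1) + (if e = y then 1 else 0) - (if e = x then 1 else 0))"
    unfolding weight_def shift_def using assms by (intro sum.cong) auto
  also have "\<dots> = weight f S + (\<Sum>e\<in>S. if e = y then 1 else 0) - (\<Sum>e\<in>S. if e = x then 1 else 0)"
    by (simp add: weight_def sum.distrib sum_subtractf)
  finally show ?thesis using fin by simp
qed

lemma shift_shift: "x \<noteq> y \<Longrightarrow> shift (shift f x y) y x = f"
  by (auto simp: shift_def)

lemma tight_shift:
  assumes "x \<noteq> y" "x \<in> U \<longleftrightarrow> y \<in> U"
  shows "tight G (shift f x y) U \<longleftrightarrow> tight G f U"
  using assms weight_shift[of U x y f] by (auto simp: tight_def)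

lemma tight_E:
  assumes G: "G \<subseteq> V \<times> E" and f: "f \<in> hypertrees V E G"
  shows "tight G f E"
proof -
  have "weight f E \<le> rank (edges_at G E)" "weight f E = int (card (V <+> E)) - 1"
    using f hypertrees_iff_rank[OF G] by (auto simp: rank_bounded_def)
  then show ?thesis using rank_le[of "edges_at G E"] by (simp add: tight_def)
qed

text \<open>Only sets containing \<open>y\<close> but not \<open>x\<close> gain weight, and they
  gain exactly one, so the inequality fails exactly at the tight ones among them.\<close>

lemma shift_hypertree_iff:
  assumes G: "G \<subseteq> V \<times> E" and f: "f \<in> hypertrees V E G" and xy: "x \<in> E" "y \<in> E" "x \<noteq> y"
  shows "shift f x y \<in> hypertrees V E G \<longleftrightarrow> exchangeable G f y x"
proof
  assume s: "shift f x y \<in> hypertrees V E G"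
  show "exchangeable G f y x"
    unfolding exchangeable_def
  proof (intro allI impI, rule ccontr)
    fix U assume U: "tight G f U" "y \<in> U" "x \<notin> U"
    have "weight (shift f x y) U \<le> rank (edges_at G U)"
      using s U hypertrees_iff_rank[OF G] by (auto simp: rank_bounded_def tight_def)
    then show False using U weight_shift[of U x y f] xy by (auto simp: tight_def)
  qed
next
  assume a: "exchangeable G f y x"
  have "weight (shift f x y) S \<le> rank (edges_at G S)" if S: "S \<subseteq> E" for S
  proof (rule ccontr)
    assume "\<not> ?thesis"
    moreover have "weight f S \<le> rank (edges_at G S)"
      using f S hypertrees_iff_rank[OF G] by (auto simp: rank_bounded_def)
    ultimately have "tight G f S" "y \<in> S" "x \<notin> S"
      using S weight_shift[OF S xy(3), of f] by (auto simp: tight_def split: if_splits)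
    then show False using a by (auto simp: exchangeable_def)
  qed
  moreover have "weight (shift f x y) E = weight f E" using weight_shift[of E x y f] xy by simp
  moreover have "shift f x y \<in> extensional E"
    using f xy hypertrees_iff_rank[OF G] by (auto simp: shift_def extensional_def)
  ultimately show "shift f x y \<in> hypertrees V E G"
    using f hypertrees_iff_rank[OF G] by (auto simp: rank_bounded_def)
qed

text \<open>If no \<open>c\<close> of \<open>A\<close> can receive from \<open>x\<close>, each has a
  tight set avoiding \<open>x\<close>, and the union of these is a single separator for all of
  \<open>A\<close>.\<close>

lemma tight_separator:
  assumes G: "G \<subseteq> V \<times> E" and f: "f \<in> hypertrees V E G" and A: "A \<subseteq> E"
  shows "(\<exists>c\<in>A. exchangeable G f c x) \<longleftrightarrow> \<not> (\<exists>U. tight G f U \<and> A \<subseteq> U \<and> x \<notin> U)"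
proof
  assume "\<exists>c\<in>A. exchangeable G f c x"
  then show "\<not> (\<exists>U. tight G f U \<and> A \<subseteq> U \<and> x \<notin> U)" by (auto simp: exchangeable_def)
next
  assume n: "\<not> (\<exists>U. tight G f U \<and> A \<subseteq> U \<and> x \<notin> U)"
  show "\<exists>c\<in>A. exchangeable G f c x"
  proof (rule ccontr)
    assume "\<not> ?thesis"
    then have "\<forall>c\<in>A. \<exists>U. tight G f U \<and> c \<in> U \<and> x \<notin> U" by (auto simp: exchangeable_def)
    then obtain U where U: "\<forall>c\<in>A. tight G f (U c) \<and> c \<in> U c \<and> x \<notin> U c" by metis
    have "tight G f (\<Union>(U ` A))"
      using f U finite_subE[OF A] hypertrees_iff_rank[OF G] by (intro tight_Union[OF G]) auto
    then show False using n U by blast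
  qed
qed

text \<open>The intersection of two separators serves for both elements. It is the set outside of
  which the shifts between \<open>x\<close> and \<open>y\<close> take place.\<close>

lemma tight_separator2:
  assumes G: "G \<subseteq> V \<times> E" and f: "f \<in> hypertrees V E G" and A: "A \<subseteq> E"
    and "\<not> (\<exists>c\<in>A. exchangeable G f c x)" "\<not> (\<exists>c\<in>A. exchangeable G f c y)"
  obtains U where "tight G f U" "A \<subseteq> U" "x \<notin> U" "y \<notin> U"
proof -
  obtain U U' where U: "tight G f U" "A \<subseteq> U" "x \<notin> U" "tight G f U'" "A \<subseteq> U'" "y \<notin> U'"
    using assms tight_separator by metis
  then have "tight G f (U \<inter> U')" using f hypertrees_iff_rank[OF G] tight_Un_Int[OF G] by blast
  then show ?thesis using U that[of "U \<inter> U'"] by blast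
qed

text \<open>For a hypertree \<open>f\<close> and \<open>e \<in> E\<close> this is the smallest tight
  set around \<open>e\<close>; it consists of the \<open>x\<close> with
  \<open>exchangeable G f e x\<close>.\<close>

definition tight_hull :: "('v \<times> 'e) set \<Rightarrow> ('e \<Rightarrow> int) \<Rightarrow> 'e \<Rightarrow> 'e set" where
  "tight_hull G f e = \<Inter>{U. tight G f U \<and> e \<in> U}"

lemma tight_hull_tight:
  assumes G: "G \<subseteq> V \<times> E" and f: "f \<in> hypertrees V E G" and e: "e \<in> E"
  shows "tight G f (tight_hull G f e)"
  unfolding tight_hull_def
proof (rule tight_Inter[OF G])
  show "finite {U. tight G f U \<and> e \<in> U}"
    by (rule finite_subset[of _ "Pow E"]) (use finE in \<open>auto simp: tight_def\<close>)
  show "{U. tight G f U \<and> e \<in> U} \<noteq> {}" using tight_E[OF G f] e by auto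
qed (use f hypertrees_iff_rank[OF G] in auto)

lemma tight_hull_mem: "e \<in> tight_hull G f e"
  by (auto simp: tight_hull_def)

lemma tight_hull_subset: "tight G f U \<Longrightarrow> e \<in> U \<Longrightarrow> tight_hull G f e \<subseteq> U"
  by (auto simp: tight_hull_def)

lemma hypertrees_mono:
  assumes "G' \<subseteq> G" "f \<in> hypertrees V E G'"
  shows "f \<in> hypertrees V E G"
proof -
  obtain T where "f \<in> E \<rightarrow>\<^sub>E {0..}" "spanning_tree (V <+> E) G' T"
    "\<forall>e\<in>E. int (degree_in T (Inr e)) = f e + 1"
    using assms(2) by (auto simp: hypertrees_def)
  moreover from this have "spanning_tree (V <+> E) G T" using assms(1) by (auto simp: spanning_tree_def)
  ultimately show ?thesis unfolding hypertrees_def by blast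
qed

text \<open>The hull lies in the tight set in which \<open>a\<close> is a bridge, and a bridge
  remains one in a smaller subgraph.\<close>

lemma forced_edge_bridge:
  assumes G: "G \<subseteq> V \<times> E" and f: "f \<in> hypertrees V E G" and a: "a \<in> G"
    and n: "f \<notin> hypertrees V E (G - {a})"
  shows "a \<notin> edge_span (edges_at G (tight_hull G f (snd a)) - {a})"
proof -
  have "G - {a} \<subseteq> V \<times> E" using G by auto
  then have "\<not> rank_bounded (G - {a}) f" "rank_bounded G f"
    using f n hypertrees_iff_rank[OF G] hypertrees_iff_rank[of "G - {a}"] by auto
  then obtain U where U: "tight G f U" "snd a \<in> U" "a \<notin> edge_span (edges_at G U - {a})"
    using tight_bridge_of_violation[OF G _ a] by blast
  have "edges_at G (tight_hull G f (snd a)) - {a} \<subseteq> edges_at G U - {a}" using tight_hull_subset[OF U(1,2)] by auto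
  then show ?thesis using U(3) edge_span_mono by blast
qed

text \<open>Take an emerald node of the cycle whose minimal tight set is maximal. Then all edges of the
  cycle except the forced edge leaving this node are spanned by a realizing tree without that edge.\<close>
lemma no_forced_cycle:
  assumes G: "G \<subseteq> V \<times> E" and f: "f \<in> hypertrees V E G"
    and xs: "distinct xs" "length xs \<ge> 3" "\<forall>i<length xs. (xs ! i, xs ! (Suc i mod length xs)) \<in> r"
    and r: "r \<subseteq> adj G" "\<And>v e. (Inr e, Inl v) \<in> r \<Longrightarrow> f \<notin> hypertrees V E (G - {(v, e)})"
  shows False
proof -
  define K where "K = {e. Inr e \<in> set xs}"
  have KE: "K \<subseteq> E"
  proof
    fix e assume "e \<in> K"
    then obtain i where "i < length xs" "xs ! i = Inr e" by (auto simp: K_def in_set_conv_nth)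
    then have "(Inr e, xs ! (Suc i mod length xs)) \<in> adj G" using xs(3) r(1) by fastforce
    then show "e \<in> E" using G by (auto simp: adj_def)
  qed
  have "K \<noteq> {}"
  proof -
    have "0 < length xs" "Suc 0 mod length xs = 1" "1 < length xs" using xs(2) by auto
    then have "(xs ! 0, xs ! 1) \<in> adj G" "xs ! 0 \<in> set xs" "xs ! 1 \<in> set xs" using xs(3) r(1)
      by (metis subsetD, auto)
    then show ?thesis by (auto simp: adj_def K_def)
  qed
  moreover have "finite K" using finite_subE[OF KE] .
  ultimately obtain e where "e \<in> K" "card (tight_hull G f e) = Max ((\<lambda>d. card (tight_hull G f d)) ` K)"
    by (metis obtains_MAX)
  with \<open>finite K\<close> have e: "e \<in> K" "\<And>d. d \<in> K \<Longrightarrow> card (tight_hull G f d) \<le> card (tight_hull G f e)"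
    by auto
  obtain k where k: "k < length xs" "xs ! k = Inr e" using e(1) by (auto simp: K_def in_set_conv_nth)
  define ys where "ys = rotate k xs"
  have ys: "distinct ys" "length ys \<ge> 3" "set ys = set xs"
    "\<forall>i<length ys. (ys ! i, ys ! (Suc i mod length ys)) \<in> r"
    using xs cyclic_list_rotate[of xs r k] by (simp_all add: ys_def)
  have "0 < length xs" using k by auto
  then have y0: "ys ! 0 = Inr e" using k nth_rotate[of 0 xs k] by (simp add: ys_def)
  have "0 < length ys" "Suc 0 mod length ys = 1" using ys(2) by auto
  then have y01: "(Inr e, ys ! 1) \<in> r" using ys(4) y0 by metis
  then have "(Inr e, ys ! 1) \<in> adj G" using r(1) by blast
  then obtain v where v: "ys ! 1 = Inl v" "(v, e) \<in> G" by (auto simp: adj_def)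
  let ?a = "(v, e)"
  have forced: "f \<notin> hypertrees V E (G - {?a})" using r(2) y01 v by simp
  have "(ys ! 1, ys ! 0) \<in> (adj {c \<in> G - {?a}. Inr (snd c) \<in> set ys})\<^sup>*"
    by (rule cycle_conn[OF ys(1,2)]) (use ys(4) r(1) v y0 in \<open>auto simp: adj_iff\<close>)
  moreover have KK: "{c \<in> G - {?a}. Inr (snd c) \<in> set ys} = {c \<in> G - {?a}. snd c \<in> K}"
    by (auto simp: K_def ys)
  ultimately have conn: "(Inl v, Inr e) \<in> (adj {c \<in> G - {?a}. snd c \<in> K})\<^sup>*"
    using v y0 by simp
  obtain T where T: "T \<subseteq> G" "realizes T f" using f hypertrees_realizes[OF G] by blast
  have TV: "T \<subseteq> V \<times> E" using T G by auto
  have aT: "?a \<in> T"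
  proof (rule ccontr)
    assume "?a \<notin> T"
    then have "T \<subseteq> G - {?a}" "G - {?a} \<subseteq> V \<times> E" using T G by auto
    moreover have "f \<in> E \<rightarrow>\<^sub>E {0..}" using f hypertrees_realizes[OF G] by simp
    ultimately show False using forced T(2) hypertrees_realizes[of "G - {?a}" f] by metis
  qed
  have "{c \<in> G - {?a}. snd c \<in> K} \<subseteq> edge_span (T - {?a})"
  proof
    fix c assume c: "c \<in> {c \<in> G - {?a}. snd c \<in> K}"
    let ?D = "tight_hull G f (snd c)"
    have eE: "e \<in> E" "snd c \<in> E" using c e KE by auto
    have tD: "tight G f ?D" using tight_hull_tight[OF G f eE(2)] .
    then have DE: "?D \<subseteq> E" by (simp add: tight_def)
    have r_eq: "rank (edges_at T ?D) = rank (edges_at G ?D)"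
      using realizes_indep_weight[OF T(2) DE] tD by (simp add: tight_def)
    have cD: "c \<in> edges_at G ?D - {?a}" using c tight_hull_mem by auto
    show "c \<in> edge_span (T - {?a})"
    \<comment> \<open>If \<open>e\<close> is outside \<open>?D\<close>, the tree edges at
      \<open>?D\<close> do not include \<open>?a\<close> and span the edges at \<open>?D\<close>.
      Otherwise \<open>?D\<close> is the hull of \<open>e\<close> by maximality, \<open>?a\<close>
      is a bridge of both the graph part and the tree part, and deleting it keeps their ranks
      equal.\<close>
    proof (cases "e \<in> ?D")
      case True
      have "tight_hull G f e \<subseteq> ?D" using tight_hull_subset[OF tD True] .
      moreover have "card ?D \<le> card (tight_hull G f e)" using e(2) c by auto
      ultimately have eqD: "tight_hull G f e = ?D" using finite_subE[OF DE] by (simp add: card_seteq)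
      then have "?a \<notin> edge_span (edges_at G ?D - {?a})" using forced_edge_bridge[OF G f v(2) forced] by simp
      moreover have aD: "?a \<in> edges_at G ?D" "?a \<in> edges_at T ?D" using v True aT by auto
      moreover have "?a \<notin> edge_span (edges_at T ?D - {?a})"
      proof -
        have "edges_at T ?D - {?a} \<subseteq> T - {?a}" by auto
        then show ?thesis using T(2) aT edge_span_mono unfolding realizes_def indep_def by blast
      qed
      ultimately have "rank (edges_at G ?D - {?a}) = rank (edges_at T ?D - {?a})"
        using rank_diff_bridge[OF edges_at_subset[OF G] aD(1)] rank_diff_bridge[OF edges_at_subset[OF TV] aD(2)] r_eq by simp
      then have "edges_at G ?D - {?a} \<subseteq> edge_span (edges_at T ?D - {?a})"
        using T G by (intro rank_spans) auto
      moreover have "edges_at T ?D - {?a} \<subseteq> T - {?a}" by auto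
      ultimately show ?thesis using cD edge_span_mono by blast
    next
      case False
      have "edges_at G ?D \<subseteq> edge_span (edges_at T ?D)" using T G r_eq by (intro rank_spans) auto
      moreover have "edges_at T ?D \<subseteq> T - {?a}" using False by auto
      ultimately show ?thesis using cD edge_span_mono by blast
    qed
  qed
  then have "(Inl v, Inr e) \<in> (adj (T - {?a}))\<^sup>*" using conn conn_edge_span by blast
  then have "?a \<in> edge_span (T - {?a})" by (simp add: edge_span_def)
  then show False using T aT by (auto simp: realizes_def indep_def)
qed

text \<open>A tight set \<open>S\<close> of \<open>H\<close> that blocks the shift would give the
  blocking set \<open>S \<union> U\<close> in \<open>G\<close>: as \<open>U\<close> is tight in
  \<open>H\<close> too, its remaining edges span all deleted ones, and the rank at
  \<open>S \<union> U\<close> is the same in both graphs.\<close>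

lemma shift_hypertree_subgraph:
  assumes G: "G \<subseteq> V \<times> E" and f: "f \<in> hypertrees V E G" "shift f x y \<in> hypertrees V E G"
    and xy: "x \<in> E" "y \<in> E" "x \<noteq> y" and U: "tight G f U" "x \<notin> U" "y \<notin> U"
    and H: "H \<subseteq> G" "snd ` (G - H) \<subseteq> U" and fH: "f \<in> hypertrees V E H"
  shows "shift f x y \<in> hypertrees V E H"
proof -
  have HV: "H \<subseteq> V \<times> E" using H G by auto
  have b: "rank_bounded H f" using fH hypertrees_iff_rank[OF HV] by simp
  have "weight (shift f x y) S \<le> rank (edges_at H S)" if S: "S \<subseteq> E" for S
  proof (rule ccontr)
    assume c: "\<not> ?thesis"
    have "weight f S \<le> rank (edges_at H S)" using b S by (simp add: rank_bounded_def)
    then have tS: "tight H f S" and yS: "y \<in> S" "x \<notin> S"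
      using c S weight_shift[OF S xy(3), of f] by (auto simp: tight_def split: if_splits)
    have UE: "U \<subseteq> E" using U by (simp add: tight_def)
    have "rank (edges_at H U) \<le> rank (edges_at G U)" using H G by (intro rank_mono) auto
    moreover have "weight f U \<le> rank (edges_at H U)" using b UE by (simp add: rank_bounded_def)
    ultimately have tU: "tight H f U" using U UE by (simp add: tight_def)
    then have "rank (edges_at G U) \<le> rank (edges_at H U)" using U by (simp add: tight_def)
    then have "edges_at G U \<subseteq> edge_span (edges_at H U)" using H G by (intro rank_spans) auto
    moreover have "edges_at H U \<subseteq> edges_at H (S \<union> U)" by auto
    ultimately have sU: "edges_at G U \<subseteq> edge_span (edges_at H (S \<union> U))" using edge_span_mono by blast
    have "edges_at G (S \<union> U) \<subseteq> edge_span (edges_at H (S \<union> U))"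
    proof
      fix c assume c: "c \<in> edges_at G (S \<union> U)"
      show "c \<in> edge_span (edges_at H (S \<union> U))"
      proof (cases "c \<in> H")
        case True then show ?thesis using c edge_span_superset[of "edges_at H (S \<union> U)"] by auto
      next
        case False
        then have "c \<in> edges_at G U" using c H by auto
        then show ?thesis using sU by blast
      qed
    qed
    then have "rank (edges_at G (S \<union> U)) = rank (edges_at H (S \<union> U))"
      using H G by (intro rank_eq_if_spans) auto
    moreover have "tight H f (S \<union> U)" using tight_Un_Int[OF HV b tS tU] by simp
    ultimately have "tight G f (S \<union> U)" by (simp add: tight_def)
    moreover have "exchangeable G f y x" using shift_hypertree_iff[OF G f(1) xy] f(2) by simp
    ultimately show False using yS U by (auto simp: exchangeable_def)
  qed
  moreover have "weight (shift f x y) E = weight f E" using weight_shift[of E x y f] xy by simp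
  ultimately show ?thesis
    using f(2) fH hypertrees_iff_rank[OF HV] hypertrees_iff_rank[OF G] by (simp add: rank_bounded_def)
qed

lemma shift_hypertree_subgraph_iff:
  assumes G: "G \<subseteq> V \<times> E" and f: "f \<in> hypertrees V E G" "shift f x y \<in> hypertrees V E G"
    and xy: "x \<in> E" "y \<in> E" "x \<noteq> y" and U: "tight G f U" "x \<notin> U" "y \<notin> U"
    and H: "H \<subseteq> G" "snd ` (G - H) \<subseteq> U"
  shows "shift f x y \<in> hypertrees V E H \<longleftrightarrow> f \<in> hypertrees V E H"
proof
  assume "shift f x y \<in> hypertrees V E H"
  then show "f \<in> hypertrees V E H"
    using shift_hypertree_subgraph[OF G f(2), of y x U H] f xy U H
    by (simp add: shift_shift tight_shift)
qed (rule shift_hypertree_subgraph[OF assms])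

end

section \<open>Adaptive orders\<close>

context bipartite_nodes
begin

lemma finite_hypertrees:
  assumes G: "G \<subseteq> V \<times> E"
  shows "finite (hypertrees V E G)"
proof (rule finite_subset)
  show "finite (E \<rightarrow>\<^sub>E {0..int (card G)})" using finE by (intro finite_PiE) auto
  show "hypertrees V E G \<subseteq> E \<rightarrow>\<^sub>E {0..int (card G)}"
  proof
    fix f assume f: "f \<in> hypertrees V E G"
    then obtain T where T: "f \<in> E \<rightarrow>\<^sub>E {0..}" "T \<subseteq> G" "realizes T f"
      using hypertrees_realizes[OF G] by auto
    have "f e \<le> int (card G)" if "e \<in> E" for e
    proof -
      have "card (edges_at T {e}) \<le> card G" using T finite_edges[OF G] by (intro card_mono) auto
      moreover have "int (card (edges_at T {e})) = f e + 1" using T(3) that by (simp add: realizes_def)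
      ultimately show ?thesis by linarith
    qed
    then show "f \<in> E \<rightarrow>\<^sub>E {0..int (card G)}" using T(1) by (auto simp: PiE_iff)
  qed
qed

text \<open>\<open>P\<close> holds the hyperedges already listed. Carrying it as a parameter allows
  a list to be cut around the pair being swapped.\<close>

fun list_inactivity :: "('v \<times> 'e) set \<Rightarrow> ('e \<Rightarrow> int) \<Rightarrow> 'e set \<Rightarrow> 'e list \<Rightarrow> nat" where
  "list_inactivity G f P [] = 0"
| "list_inactivity G f P (x # xs) = (if \<exists>c\<in>P. exchangeable G f c x then 1 else 0) + list_inactivity G f (insert x P) xs"

lemma list_inactivity_append: "list_inactivity G f P (xs @ ys) = list_inactivity G f P xs + list_inactivity G f (P \<union> set xs) ys"
  by (induction xs arbitrary: P) auto

lemma list_inactivity_cong: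
  assumes "\<And>Q z. P \<subseteq> Q \<Longrightarrow> Q \<subseteq> P \<union> set xs \<Longrightarrow> (\<exists>c\<in>Q. exchangeable G f c z) \<longleftrightarrow> (\<exists>c\<in>Q. exchangeable G f' c z)"
  shows "list_inactivity G f P xs = list_inactivity G f' P xs"
  using assms
proof (induction xs arbitrary: P)
  case (Cons x xs)
  have "list_inactivity G f (insert x P) xs = list_inactivity G f' (insert x P) xs"
    by (rule Cons.IH) (use Cons.prems in auto)
  moreover have "(\<exists>c\<in>P. exchangeable G f c x) \<longleftrightarrow> (\<exists>c\<in>P. exchangeable G f' c x)"
    by (rule Cons.prems) auto
  ultimately show ?case by simp
qed simp

lemma exchangeable_trans: "exchangeable G f c d \<Longrightarrow> exchangeable G f d e \<Longrightarrow> exchangeable G f c e"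
  by (auto simp: exchangeable_def)

text \<open>A separator \<open>W\<close> for \<open>f\<close> yields one for the shifted vector:
  \<open>W \<inter> U\<close> contains neither \<open>a\<close> nor \<open>b\<close>, and
  \<open>W\<close> contains both once \<open>Q\<close> does. These two shapes of \<open>Q\<close>
  are the prefixes before and after the swapped pair.\<close>

lemma exchangeable_shift_aux:
  assumes G: "G \<subseteq> V \<times> E" and f: "f \<in> hypertrees V E G" "shift f a b \<in> hypertrees V E G"
    and ab: "a \<in> E" "b \<in> E" "a \<noteq> b" and U: "tight G f U" "a \<notin> U" "b \<notin> U"
    and Q: "Q \<subseteq> E" "Q \<subseteq> U \<or> a \<in> Q \<and> b \<in> Q" and c: "\<exists>c\<in>Q. exchangeable G (shift f a b) c z"
  shows "\<exists>c\<in>Q. exchangeable G f c z"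
proof (rule ccontr)
  assume "\<not> ?thesis"
  then obtain W where W: "tight G f W" "Q \<subseteq> W" "z \<notin> W"
    using tight_separator[OF G f(1) Q(1), of z] by auto
  have WU: "tight G f (W \<inter> U)" using f(1) W U hypertrees_iff_rank[OF G] tight_Un_Int[OF G] by blast
  have "\<exists>W. tight G (shift f a b) W \<and> Q \<subseteq> W \<and> z \<notin> W"
  proof (cases "Q \<subseteq> U")
    case True
    then show ?thesis using WU W U ab tight_shift[of a b "W \<inter> U" G f] by (intro exI[of _ "W \<inter> U"]) auto
  next
    case False
    then show ?thesis using W Q ab tight_shift[of a b W G f] by (intro exI[of _ W]) auto
  qed
  then show False using c tight_separator[OF G f(2) Q(1), of z] by simp
qed

lemma exchangeable_shift:
  assumes G: "G \<subseteq> V \<times> E" and f: "f \<in> hypertrees V E G" "shift f a b \<in> hypertrees V E G"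
    and ab: "a \<in> E" "b \<in> E" "a \<noteq> b" and U: "tight G f U" "a \<notin> U" "b \<notin> U"
    and Q: "Q \<subseteq> E" "Q \<subseteq> U \<or> a \<in> Q \<and> b \<in> Q"
  shows "(\<exists>c\<in>Q. exchangeable G f c z) \<longleftrightarrow> (\<exists>c\<in>Q. exchangeable G (shift f a b) c z)"
  using exchangeable_shift_aux[OF assms, of z] exchangeable_shift_aux[OF G f(2), of b a U Q z] assms
  by (auto simp: shift_shift tight_shift)

text \<open>\<open>A\<close> is the part of the order that stays fixed; the class contains the
  partners of its members under the swaps that happen beyond \<open>A\<close>.\<close>

definition shift_closed :: "('v \<times> 'e) set \<Rightarrow> 'e set \<Rightarrow> ('e \<Rightarrow> int) set \<Rightarrow> bool" where
  "shift_closed G A F \<longleftrightarrow> F \<subseteq> hypertrees V E G \<and>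
    (\<forall>f\<in>F. \<forall>U. \<forall>x\<in>E - U. \<forall>y\<in>E - U. tight G f U \<longrightarrow> A \<subseteq> U \<longrightarrow> x \<noteq> y \<longrightarrow>
      shift f x y \<in> hypertrees V E G \<longrightarrow> shift f x y \<in> F)"

lemma shift_closedD:
  assumes "shift_closed G A F" "f \<in> F" "tight G f U" "A \<subseteq> U" "x \<in> E" "x \<notin> U" "y \<in> E" "y \<notin> U" "x \<noteq> y"
    "shift f x y \<in> hypertrees V E G"
  shows "shift f x y \<in> F"
  using assms unfolding shift_closed_def by blast

text \<open>Only hypertrees for which neither \<open>a\<close> nor \<open>b\<close> is reached from the prefix are affected by the
  swap, and among them \<open>f \<mapsto> f - b + a\<close> is a bijection from those with
  \<open>exchangeable G f a b\<close> onto those with \<open>exchangeable G f b a\<close> that preserves the activity of all other hyperedges.\<close>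
lemma sum_list_inactivity_swap:
  assumes G: "G \<subseteq> V \<times> E" and F: "shift_closed G A F" and A: "A \<subseteq> set p"
    and E: "set p \<subseteq> E" "set q \<subseteq> E" "a \<in> E" "b \<in> E" "a \<noteq> b"
  shows "(\<Sum>f\<in>F. monom (1::int) (list_inactivity G f {} (p @ a # b # q))) =
    (\<Sum>f\<in>F. monom 1 (list_inactivity G f {} (p @ b # a # q)))"
proof -
  let ?P = "set p"
  let ?r = "\<lambda>f x. \<exists>c\<in>?P. exchangeable G f c x"
  define F1 where "F1 = {f \<in> F. ?r f a \<or> ?r f b}"
  define F2 where "F2 = {f \<in> F. \<not> ?r f a \<and> \<not> ?r f b}"
  define n where "n f = list_inactivity G f {} p + list_inactivity G f (insert a (insert b ?P)) q" for f
  have FB: "F \<subseteq> hypertrees V E G" using F by (simp add: shift_closed_def)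
  have fin: "finite F" using FB finite_hypertrees[OF G] finite_subset by blast
  have ab: "list_inactivity G f {} (p @ a # b # q) =
      n f + (if ?r f a then 1 else 0) + (if ?r f b \<or> exchangeable G f a b then 1 else 0)"
    and ba: "list_inactivity G f {} (p @ b # a # q) =
      n f + (if ?r f b then 1 else 0) + (if ?r f a \<or> exchangeable G f b a then 1 else 0)" for f
    by (auto simp: list_inactivity_append n_def insert_commute)
  \<comment> \<open>Once the prefix can receive from \<open>a\<close>,
    \<open>exchangeable G f a b\<close> adds nothing for \<open>b\<close> by transitivity, and
    likewise with the roles exchanged.\<close>
  have F1: "list_inactivity G f {} (p @ a # b # q) = list_inactivity G f {} (p @ b # a # q)" if "f \<in> F1" for f
    using that exchangeable_trans[of G f _ a b] exchangeable_trans[of G f _ b a] unfolding ab ba by (auto simp: F1_def)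
  have step: "shift f y x \<in> F2 \<and> exchangeable G (shift f y x) y x \<and> n (shift f y x) = n f"
    if xy: "{x, y} = {a, b}" and f: "f \<in> F2" "exchangeable G f x y" for f x y
  proof -
    have xyE: "x \<in> E" "y \<in> E" "x \<noteq> y" using xy E by (auto simp: doubleton_eq_iff)
    have fF: "f \<in> F" and fB: "f \<in> hypertrees V E G" using f FB by (auto simp: F2_def)
    have "\<not> ?r f x" "\<not> ?r f y" using f xy by (auto simp: F2_def doubleton_eq_iff)
    then obtain U where U: "tight G f U" "?P \<subseteq> U" "x \<notin> U" "y \<notin> U"
      using tight_separator2[OF G fB E(1)] by blast
    let ?g = "shift f y x"
    have gB: "?g \<in> hypertrees V E G" using shift_hypertree_iff[OF G fB xyE(2,1)] xyE f by simp
    then have gF: "?g \<in> F" using shift_closedD[OF F fF U(1) _ xyE(2) U(4) xyE(1) U(3)] U(2) A xyE by blast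
    have tU: "tight G ?g U" using tight_shift[of y x U G f] U xyE by simp
    then have "\<not> ?r ?g x" "\<not> ?r ?g y" using U by (auto simp: exchangeable_def)
    then have "?g \<in> F2" using gF xy by (auto simp: F2_def doubleton_eq_iff)
    moreover have "exchangeable G ?g y x"
      using shift_hypertree_iff[OF G gB xyE] fB shift_shift[of y x f] xyE by simp
    moreover have "list_inactivity G f {} p = list_inactivity G ?g {} p"
    proof (rule list_inactivity_cong)
      fix Q z assume "Q \<subseteq> {} \<union> ?P"
      then have "Q \<subseteq> E" "Q \<subseteq> U" using E(1) U(2) by auto
      then show "(\<exists>c\<in>Q. exchangeable G f c z) = (\<exists>c\<in>Q. exchangeable G ?g c z)"
        using exchangeable_shift[OF G fB gB xyE(2,1) xyE(3)[symmetric] U(1,4,3)] by blast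
    qed
    moreover have "list_inactivity G f (insert a (insert b ?P)) q = list_inactivity G ?g (insert a (insert b ?P)) q"
    proof (rule list_inactivity_cong)
      fix Q z assume Q: "insert a (insert b ?P) \<subseteq> Q" "Q \<subseteq> insert a (insert b ?P) \<union> set q"
      then have "Q \<subseteq> E" "y \<in> Q \<and> x \<in> Q" using E xy by (auto simp: doubleton_eq_iff)
      then show "(\<exists>c\<in>Q. exchangeable G f c z) = (\<exists>c\<in>Q. exchangeable G ?g c z)"
        using exchangeable_shift[OF G fB gB xyE(2,1) xyE(3)[symmetric] U(1,4,3)] by blast
    qed
    ultimately show ?thesis by (simp add: n_def)
  qed
  have bij: "(\<Sum>f | f \<in> F2 \<and> exchangeable G f a b. monom (1::int) (n f + k)) =
      (\<Sum>f | f \<in> F2 \<and> exchangeable G f b a. monom 1 (n f + k))" for k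
    by (rule sum.reindex_bij_witness[of _ "\<lambda>f. shift f a b" "\<lambda>f. shift f b a"])
       (use step[of a b] step[of b a] E(5) shift_shift[of a b] shift_shift[of b a] in \<open>auto simp: insert_commute\<close>)
  have fin2: "finite F2" using fin by (simp add: F2_def)
  \<comment> \<open>Isolates the affected terms in the form of \<open>bij\<close>, for
    \<open>k = 0\<close> and \<open>k = 1\<close>; the summand \<open>0\<close> is kept for this
    match.\<close>
  have split: "(\<Sum>f\<in>F2. monom (1::int) (n f + (if Q f then 1 else 0))) =
      (\<Sum>f\<in>F2. monom 1 (n f)) - (\<Sum>f | f \<in> F2 \<and> Q f. monom 1 (n f + 0)) + (\<Sum>f | f \<in> F2 \<and> Q f. monom 1 (n f + 1))" for Q
  proof -
    have "F2 \<inter> {f. Q f} = {f. f \<in> F2 \<and> Q f}" by auto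
    then have "(\<Sum>f\<in>F2. monom (1::int) (n f + (if Q f then 1 else 0))) =
      (\<Sum>f | f \<in> F2 \<and> Q f. monom 1 (n f + 1)) + (\<Sum>f\<in>F2 \<inter> - {f. Q f}. monom 1 (n f))"
      using sum.If_cases[OF fin2, of Q "\<lambda>f. monom (1::int) (n f + 1)" "\<lambda>f. monom 1 (n f)"]
      by (simp add: if_distrib cong: if_cong)
    moreover have "(\<Sum>f\<in>F2. monom (1::int) (n f)) =
      (\<Sum>f | f \<in> F2 \<and> Q f. monom 1 (n f)) + (\<Sum>f\<in>F2 \<inter> - {f. Q f}. monom 1 (n f))"
      using sum.If_cases[OF fin2, of Q "\<lambda>f. monom (1::int) (n f)" "\<lambda>f. monom 1 (n f)"] \<open>F2 \<inter> {f. Q f} = _\<close>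
      by simp
    ultimately show ?thesis by simp
  qed
  have "(\<Sum>f\<in>F2. monom (1::int) (list_inactivity G f {} (p @ a # b # q))) =
      (\<Sum>f\<in>F2. monom 1 (n f + (if exchangeable G f a b then 1 else 0)))"
    by (rule sum.cong) (auto simp: ab F2_def)
  also have "\<dots> = (\<Sum>f\<in>F2. monom 1 (n f + (if exchangeable G f b a then 1 else 0)))"
    unfolding split bij ..
  also have "\<dots> = (\<Sum>f\<in>F2. monom (1::int) (list_inactivity G f {} (p @ b # a # q)))"
    by (rule sum.cong) (auto simp: ba F2_def)
  finally have "(\<Sum>f\<in>F2. monom (1::int) (list_inactivity G f {} (p @ a # b # q))) =
      (\<Sum>f\<in>F2. monom (1::int) (list_inactivity G f {} (p @ b # a # q)))" .
  moreover have "F = F1 \<union> F2" "F1 \<inter> F2 = {}" "finite F1" using fin by (auto simp: F1_def F2_def)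
  ultimately show ?thesis using fin2 F1 by (simp add: sum.union_disjoint)
qed

lemma sum_list_inactivity_to_front:
  assumes G: "G \<subseteq> V \<times> E" and F: "shift_closed G A F" and A: "A \<subseteq> set p"
    and "set p \<subseteq> E" "set u \<subseteq> E" "set q \<subseteq> E" "a \<in> E" "a \<notin> set u"
  shows "(\<Sum>f\<in>F. monom (1::int) (list_inactivity G f {} (p @ u @ a # q))) =
    (\<Sum>f\<in>F. monom 1 (list_inactivity G f {} (p @ a # u @ q)))"
  using assms(5-8)
proof (induction u arbitrary: q rule: rev_induct)
  case (snoc b u)
  have "(\<Sum>f\<in>F. monom (1::int) (list_inactivity G f {} ((p @ u) @ b # a # q))) =
      (\<Sum>f\<in>F. monom 1 (list_inactivity G f {} ((p @ u) @ a # b # q)))"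
    by (rule sum_list_inactivity_swap[OF G F]) (use A assms(4) snoc.prems in auto)
  also have "\<dots> = (\<Sum>f\<in>F. monom 1 (list_inactivity G f {} (p @ u @ a # b # q)))" by simp
  also have "\<dots> = (\<Sum>f\<in>F. monom 1 (list_inactivity G f {} (p @ a # u @ b # q)))"
    by (rule snoc.IH) (use snoc.prems in auto)
  finally show ?case by simp
qed simp

text \<open>The orders that follow \<open>w f\<close> for the first \<open>k\<close> hyperedges and then \<open>r\<close> interpolate between
  \<open>r\<close> and \<open>w f\<close>.\<close>
lemma sum_list_inactivity_adaptive:
  assumes G: "G \<subseteq> V \<times> E"
    and w: "\<And>f. f \<in> hypertrees V E G \<Longrightarrow> distinct (w f) \<and> set (w f) = E"
    and r: "distinct r" "set r = E"
    and adaptive: "\<And>f k U x y. f \<in> hypertrees V E G \<Longrightarrow> k < card E \<Longrightarrow> tight G f U \<Longrightarrow>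
      set (take k (w f)) \<subseteq> U \<Longrightarrow> x \<in> E - U \<Longrightarrow> y \<in> E - U \<Longrightarrow> x \<noteq> y \<Longrightarrow>
      shift f x y \<in> hypertrees V E G \<Longrightarrow> take (Suc k) (w (shift f x y)) = take (Suc k) (w f)"
  shows "(\<Sum>f\<in>hypertrees V E G. monom (1::int) (list_inactivity G f {} (w f))) =
    (\<Sum>f\<in>hypertrees V E G. monom 1 (list_inactivity G f {} r))"
proof -
  let ?B = "hypertrees V E G"
  define H where "H k f = take k (w f) @ filter (\<lambda>e. e \<notin> set (take k (w f))) r" for k f
  have len: "length (w f) = card E" if "f \<in> ?B" for f using w[OF that] distinct_card by metis
  have step: "(\<Sum>f\<in>?B. monom (1::int) (list_inactivity G f {} (H k f))) = (\<Sum>f\<in>?B. monom 1 (list_inactivity G f {} (H (Suc k) f)))"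
    if k: "k < card E" for k
  proof -
    \<comment> \<open>Within the group of hypertrees sharing the first \<open>Suc k\<close> entries
      \<open>s\<close> of \<open>w f\<close>, both stages are constant lists. They differ by moving
      the last entry of \<open>s\<close> to the front of the tail.\<close>
    have "(\<Sum>f | f \<in> ?B \<and> take (Suc k) (w f) = s. monom (1::int) (list_inactivity G f {} (H k f))) =
        (\<Sum>f | f \<in> ?B \<and> take (Suc k) (w f) = s. monom 1 (list_inactivity G f {} (H (Suc k) f)))"
      if s: "s \<in> (\<lambda>f. take (Suc k) (w f)) ` ?B" for s
    proof -
      let ?F = "{f. f \<in> ?B \<and> take (Suc k) (w f) = s}"
      obtain f0 where f0: "f0 \<in> ?B" "s = take (Suc k) (w f0)" using s by blast
      define p where "p = take k (w f0)"
      define a where "a = w f0 ! k"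
      have s_eq: "s = p @ [a]"
        using f0 len k by (simp add: p_def a_def take_Suc_conv_app_nth)
      have tk: "take k (w f) = p" if "f \<in> ?F" for f
      proof -
        have "take k (take (Suc k) (w f)) = take k (take (Suc k) (w f0))" using that f0 by auto
        then show ?thesis by (simp add: p_def)
      qed
      have "distinct s" "set s \<subseteq> E" using w f0 by (auto simp: distinct_take dest: in_set_takeD)
      then have a: "a \<notin> set p" "a \<in> E" "set p \<subseteq> E" using s_eq by auto
      then have "a \<in> set (filter (\<lambda>e. e \<notin> set p) r)" using r by auto
      then obtain u q where uq: "filter (\<lambda>e. e \<notin> set p) r = u @ a # q" by (meson split_list)
      have "distinct (u @ a # q)" "set (u @ a # q) \<subseteq> E"
        using r uq by (metis distinct_filter, metis filter_is_subset)
      have keep: "filter (\<lambda>e. e \<noteq> a) xs = xs" if "a \<notin> set xs" for xs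
        using that by (intro filter_True) auto
      have "filter (\<lambda>e. e \<notin> set s) r = filter (\<lambda>e. e \<noteq> a) (filter (\<lambda>e. e \<notin> set p) r)"
        by (simp add: s_eq conj_commute)
      also have "\<dots> = u @ q"
        unfolding uq using \<open>distinct (u @ a # q)\<close> by (simp add: keep)
      finally have fs: "filter (\<lambda>e. e \<notin> set s) r = u @ q" .
      \<comment> \<open>The closure concerns \<open>set p\<close>, since \<open>a\<close> itself
        takes part in the shifts, yet the class fixes \<open>a\<close> as well. This is why
        \<open>adaptive\<close> promises \<open>Suc k\<close> entries from an inclusion for
        \<open>k\<close> of them.\<close>
      have closed: "shift_closed G (set p) ?F"
        unfolding shift_closed_def
      proof (intro conjI ballI allI impI)
        fix f U x y assume "f \<in> ?F" "x \<in> E - U" "y \<in> E - U" "tight G f U" "set p \<subseteq> U" "x \<noteq> y"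
          "shift f x y \<in> ?B"
        then show "shift f x y \<in> ?F" using adaptive[of f k U x y] k tk[of f] by auto
      qed auto
      have "(\<Sum>f\<in>?F. monom (1::int) (list_inactivity G f {} (H k f))) =
          (\<Sum>f\<in>?F. monom 1 (list_inactivity G f {} (p @ u @ a # q)))"
        using tk by (intro sum.cong) (simp_all add: H_def uq)
      also have "\<dots> = (\<Sum>f\<in>?F. monom 1 (list_inactivity G f {} (p @ a # u @ q)))"
        by (rule sum_list_inactivity_to_front[OF G closed]) (use a \<open>distinct (u @ a # q)\<close> \<open>set (u @ a # q) \<subseteq> E\<close> in auto)
      also have "\<dots> = (\<Sum>f\<in>?F. monom 1 (list_inactivity G f {} (H (Suc k) f)))"
      proof (rule sum.cong[OF refl])
        fix f assume "f \<in> ?F"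
        then have "H (Suc k) f = s @ u @ q" using fs by (simp add: H_def)
        then show "monom (1::int) (list_inactivity G f {} (p @ a # u @ q)) = monom 1 (list_inactivity G f {} (H (Suc k) f))"
          by (simp add: s_eq)
      qed
      finally show ?thesis .
    qed
    then show ?thesis
      unfolding sum.image_gen[OF finite_hypertrees[OF G], of _ "\<lambda>f. take (Suc k) (w f)"]
      by (rule sum.cong[OF refl])
  qed
  have "k \<le> card E \<Longrightarrow> (\<Sum>f\<in>?B. monom (1::int) (list_inactivity G f {} (H k f))) = (\<Sum>f\<in>?B. monom 1 (list_inactivity G f {} (H 0 f)))" for k
    by (induction k) (use step in auto)
  from this[of "card E"] have "(\<Sum>f\<in>?B. monom (1::int) (list_inactivity G f {} (H (card E) f))) = (\<Sum>f\<in>?B. monom 1 (list_inactivity G f {} (H 0 f)))"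
    by simp
  moreover have "H (card E) f = w f" if "f \<in> ?B" for f
    using w[OF that] len[OF that] r by (simp add: H_def)
  ultimately show ?thesis by (simp add: H_def)
qed

lemma internal_inactivity_eq_list_inactivity:
  assumes G: "G \<subseteq> V \<times> E" and f: "f \<in> hypertrees V E G"
    and xs: "distinct xs" "set xs = E" "sorted_wrt (\<lambda>y x. (y, x) \<in> L) xs"
    and L: "\<And>x y. (x, y) \<in> L \<Longrightarrow> (y, x) \<notin> L"
  shows "internal_inactivity V E G L f = list_inactivity G f {} xs"
proof -
  \<comment> \<open>Generalized over a set \<open>P\<close> of earlier hyperedges, into which the
    head of the list moves in the induction.\<close>
  have gen: "card {x \<in> set xs. \<exists>c\<in>P \<union> {y \<in> set xs. (y, x) \<in> L}. exchangeable G f c x} = list_inactivity G f P xs"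
    if "distinct xs" "sorted_wrt (\<lambda>y x. (y, x) \<in> L) xs" for P xs
    using that
  proof (induction xs arbitrary: P)
    case (Cons z xs)
    let ?S = "{x \<in> set xs. \<exists>c\<in>insert z P \<union> {y \<in> set xs. (y, x) \<in> L}. exchangeable G f c x}"
    have nz: "(z, z) \<notin> L" "\<And>x. x \<in> set xs \<Longrightarrow> (z, x) \<in> L \<and> (x, z) \<notin> L"
      using L Cons.prems by auto
    have "{x \<in> set (z # xs). \<exists>c\<in>P \<union> {y \<in> set (z # xs). (y, x) \<in> L}. exchangeable G f c x} =
        (if \<exists>c\<in>P. exchangeable G f c z then {z} else {}) \<union> ?S"
      using nz by auto
    moreover have "z \<notin> ?S" using Cons.prems by simp
    moreover have "card ?S = list_inactivity G f (insert z P) xs"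
    proof (rule Cons.IH)
      show "distinct xs" "sorted_wrt (\<lambda>y x. (y, x) \<in> L) xs" using Cons.prems by simp_all
    qed
    ultimately show ?case by (auto simp: card_insert_if)
  qed simp
  have "{e \<in> E. \<not> internally_active V E G L f e} = {x \<in> set xs. \<exists>c\<in>{} \<union> {y \<in> set xs. (y, x) \<in> L}. exchangeable G f c x}"
  proof -
    have "(f(e := f e - 1, e' := f e' + 1) \<in> hypertrees V E G) = exchangeable G f e' e"
      if "e \<in> E" "e' \<in> E" "(e', e) \<in> L" for e e'
      using shift_hypertree_iff[OF G f, of e e'] that L by (auto simp: shift_def)
    then show ?thesis unfolding internally_active_def xs(2) by blast
  qed
  then show ?thesis unfolding internal_inactivity_def using gen[OF xs(1,3), of "{}"] by simp
qed

end

section \<open>Faces of a ribbon graph\<close>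

text \<open>Two iterates coincide by finiteness, and injectivity cancels the common initial
  steps.\<close>

lemma funpow_return:
  assumes "finite D" "f ` D \<subseteq> D" "inj_on f D" "p \<in> D"
  obtains n where "0 < n" "(f ^^ n) p = p"
proof -
  have D: "(f ^^ n) p \<in> D" for n using assms(2,4) by (induction n) auto
  then have "\<not> inj (\<lambda>n. (f ^^ n) p)"
    using assms(1) finite_subset[of "range (\<lambda>n. (f ^^ n) p)" D] finite_imageD by blast
  then obtain i j where ij: "i < j" "(f ^^ i) p = (f ^^ j) p"
    by (metis (mono_tags, lifting) injI linorder_neqE_nat)
  have "(f ^^ (i - k)) p = (f ^^ (j - k)) p" if "k \<le> i" for k
    using that
  proof (induction k)
    case (Suc k)
    then have "f ((f ^^ (i - Suc k)) p) = f ((f ^^ (j - Suc k)) p)"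
      using ij(1) by (metis Suc_diff_Suc Suc_le_lessD funpow.simps(2) o_apply Suc_leD order_less_trans)
    then show ?case using assms(3) D by (auto dest: inj_onD)
  qed (use ij in simp)
  from this[of i] have "(f ^^ (j - i)) p = p" by simp
  then show ?thesis using that[of "j - i"] ij by simp
qed

locale ribbon_graph = bipartite_nodes V E for V :: "'v set" and E :: "'e set" +
  fixes B :: "('v \<times> 'e) set" and \<rho> :: "'v + 'e \<Rightarrow> 'v \<times> 'e \<Rightarrow> 'v \<times> 'e"
  assumes B_sub: "B \<subseteq> V \<times> E" and E_nonempty: "E \<noteq> {}"
    and ribbon: "ribbon_structure (V <+> E) B \<rho>"
begin

abbreviation succ :: "('v \<times> 'e) set \<Rightarrow> 'v + 'e \<Rightarrow> 'v \<times> 'e \<Rightarrow> 'v \<times> 'e" where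
  "succ \<equiv> succ_in \<rho>"

lemma incident_mono: "G \<subseteq> G' \<Longrightarrow> incident G x \<subseteq> incident G' x"
  by (auto simp: incident_def)

lemma cyclic:
  assumes "a \<in> incident B x"
  shows "cyclic_on (\<rho> x) (incident B x)"
proof -
  have "x \<in> V <+> E" using assms B_sub by (auto simp: incident_def)
  then show ?thesis using ribbon assms by (auto simp: ribbon_structure_def)
qed

lemma funpow_incident: "a \<in> incident B x \<Longrightarrow> (\<rho> x ^^ k) a \<in> incident B x"
  using cyclic cyclic_on_funpow_in by metis

lemma funpow_reaches:
  assumes "a \<in> incident B x" "c \<in> incident B x"
  obtains k where "0 < k" "(\<rho> x ^^ k) a = c"
proof -
  have "c \<in> orbit (\<rho> x) a" using cyclic[OF assms(1)] assms by (auto simp: cyclic_on_alldef)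
  then show ?thesis using that by (auto simp: orbit_altdef)
qed

lemma succ_spec:
  assumes "G \<subseteq> B" "a \<in> incident B x" "incident G x \<noteq> {}"
  obtains k where "0 < k" "succ G x a = (\<rho> x ^^ k) a" "(\<rho> x ^^ k) a \<in> G"
    "\<And>j. 0 < j \<Longrightarrow> j < k \<Longrightarrow> (\<rho> x ^^ j) a \<notin> G"
proof -
  obtain c where c: "c \<in> incident G x" using assms by blast
  then have "c \<in> incident B x" using incident_mono[OF assms(1)] by blast
  then obtain k where "0 < k" "(\<rho> x ^^ k) a = c" using funpow_reaches assms by metis
  then have ex: "0 < k \<and> (\<rho> x ^^ k) a \<in> G" using c by (simp add: incident_def)
  let ?P = "\<lambda>k. 0 < k \<and> (\<rho> x ^^ k) a \<in> G"
  have "?P (Least ?P)" using ex by (rule LeastI)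
  moreover have "\<not> ?P j" if "j < Least ?P" for j using that by (rule not_less_Least)
  ultimately show ?thesis by (intro that[of "Least ?P"]) (auto simp: succ_in_def)
qed

lemma succ_eqI:
  assumes "0 < k" "(\<rho> x ^^ k) a \<in> G" "\<And>j. 0 < j \<Longrightarrow> j < k \<Longrightarrow> (\<rho> x ^^ j) a \<notin> G"
  shows "succ G x a = (\<rho> x ^^ k) a"
proof -
  have "(LEAST k. 0 < k \<and> (\<rho> x ^^ k) a \<in> G) = k"
    by (rule Least_equality) (use assms not_less in blast)+
  then show ?thesis by (simp add: succ_in_def)
qed

lemma succ_mem:
  assumes "G \<subseteq> B" "a \<in> incident B x" "incident G x \<noteq> {}"
  shows "succ G x a \<in> incident G x"
proof -
  obtain k where "succ G x a = (\<rho> x ^^ k) a" "(\<rho> x ^^ k) a \<in> G"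
    using succ_spec[OF assms] by metis
  then show ?thesis using funpow_incident[OF assms(2), of k] by (simp add: incident_def)
qed

lemma succ_inj:
  assumes "G \<subseteq> B" "a \<in> incident G x" "a' \<in> incident G x" "succ G x a = succ G x a'"
  shows "a = a'"
proof -
  have B: "a \<in> incident B x" "a' \<in> incident B x" using assms incident_mono by blast+
  have ne: "incident G x \<noteq> {}" using assms by blast
  have inj: "inj (\<rho> x ^^ k)" for k
  proof -
    have "x \<in> V <+> E" using B B_sub by (auto simp: incident_def)
    then have "bij (\<rho> x)" using ribbon permutes_bij by (auto simp: ribbon_structure_def)
    then show ?thesis by (simp add: bij_is_inj inj_fn)
  qed
  \<comment> \<open>Cancelling \<open>k\<close> steps puts \<open>c\<close> at \<open>k' - k\<close>
    steps from \<open>c'\<close>, earlier than the first edge of \<open>G\<close> after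
    \<open>c'\<close> unless \<open>k' = k\<close>.\<close>
  have *: "c = c'" if "k \<le> k'" "(\<rho> x ^^ k) c = (\<rho> x ^^ k') c'" "c \<in> G"
    "\<And>j. 0 < j \<Longrightarrow> j < k' \<Longrightarrow> (\<rho> x ^^ j) c' \<notin> G" "0 < k" for c c' k k'
  proof -
    have "(\<rho> x ^^ k) c = (\<rho> x ^^ k) ((\<rho> x ^^ (k' - k)) c')"
      using that(1,2) by (metis comp_apply funpow_add le_add_diff_inverse)
    then have c: "c = (\<rho> x ^^ (k' - k)) c'" using inj by (meson injD)
    then have "\<not> (0 < k' - k \<and> k' - k < k')" using that(3,4) by metis
    then have "k' - k = 0" using that(1,5) by linarith
    then show ?thesis using c by simp
  qed
  obtain k where k: "0 < k" "succ G x a = (\<rho> x ^^ k) a" "\<And>j. 0 < j \<Longrightarrow> j < k \<Longrightarrow> (\<rho> x ^^ j) a \<notin> G"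
    using succ_spec[OF assms(1) B(1) ne] by metis
  obtain k' where k': "0 < k'" "succ G x a' = (\<rho> x ^^ k') a'" "\<And>j. 0 < j \<Longrightarrow> j < k' \<Longrightarrow> (\<rho> x ^^ j) a' \<notin> G"
    using succ_spec[OF assms(1) B(2) ne] by metis
  have G: "a \<in> G" "a' \<in> G" using assms by (auto simp: incident_def)
  show ?thesis
    using *[of k k' a a'] *[of k' k a' a] k k' G assms(4) by (metis nle_le)
qed

text \<open>The restricted rotation is again a single cycle: a walk by \<open>\<rho> x\<close> from
  \<open>a\<close> to an edge of \<open>G\<close> first meets the successor of \<open>a\<close>,
  from where a shorter walk remains.\<close>

lemma succ_closed:
  assumes "G \<subseteq> B" "a \<in> incident G x" "a \<in> Z" "\<And>c. c \<in> Z \<Longrightarrow> c \<in> incident G x \<Longrightarrow> succ G x c \<in> Z"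
  shows "incident G x \<subseteq> Z"
proof
  fix c assume c: "c \<in> incident G x"
  have "\<And>a. a \<in> Z \<Longrightarrow> a \<in> incident G x \<Longrightarrow> (\<rho> x ^^ m) a \<in> G \<Longrightarrow> (\<rho> x ^^ m) a \<in> Z" for m
  proof (induction m rule: less_induct)
    case (less m)
    show ?case
    proof (cases "m = 0")
      case False
      have aB: "a \<in> incident B x" using less.prems incident_mono[OF assms(1)] by blast
      obtain k where k: "0 < k" "succ G x a = (\<rho> x ^^ k) a" "\<And>j. 0 < j \<Longrightarrow> j < k \<Longrightarrow> (\<rho> x ^^ j) a \<notin> G"
        using succ_spec[OF assms(1) aB] less.prems by (metis empty_iff)
      then have le: "k \<le> m" using less.prems False by (meson bot_nat_0.not_eq_extremum not_le)
      then have eq: "(\<rho> x ^^ (m - k)) (succ G x a) = (\<rho> x ^^ m) a"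
        using k(2) by (metis comp_apply funpow_add le_add_diff_inverse2)
      have "succ G x a \<in> Z" using less.prems assms(4) by blast
      moreover have "succ G x a \<in> incident G x" using succ_mem[OF assms(1) aB] less.prems by blast
      moreover have "m - k < m" using k le by simp
      ultimately show ?thesis using less.IH[of "m - k" "succ G x a"] eq less.prems by simp
    qed (use less.prems in simp)
  qed
  moreover obtain m where "(\<rho> x ^^ m) a = c"
    using funpow_reaches[of a x c] assms c incident_mono[OF assms(1)] by (metis subsetD)
  moreover have "c \<in> G" using c by (simp add: incident_def)
  ultimately show "c \<in> Z" using assms by blast
qed

lemma succ_delete_other:
  assumes "G \<subseteq> B" "c \<in> incident G x" "succ G x c \<noteq> a"
  shows "succ (G - {a}) x c = succ G x c"
proof -
  have "c \<in> incident B x" using assms incident_mono by blast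
  then obtain k where k: "0 < k" "succ G x c = (\<rho> x ^^ k) c" "(\<rho> x ^^ k) c \<in> G"
    "\<And>j. 0 < j \<Longrightarrow> j < k \<Longrightarrow> (\<rho> x ^^ j) c \<notin> G"
    using succ_spec[OF assms(1)] assms(2) by (metis empty_iff)
  then show ?thesis using succ_eqI[of k x c "G - {a}"] assms(3) by auto
qed

text \<open>This redirection keeps the face walk intact when the process removes the current
  edge.\<close>

lemma succ_delete:
  assumes "G \<subseteq> B" "c \<in> incident G x" "c \<noteq> a" "succ G x c = a"
  shows "succ (G - {a}) x c = succ G x a"
proof -
  have cB: "c \<in> incident B x" using assms incident_mono by blast
  then obtain k where k: "0 < k" "a = (\<rho> x ^^ k) c" "(\<rho> x ^^ k) c \<in> G"
    "\<And>j. 0 < j \<Longrightarrow> j < k \<Longrightarrow> (\<rho> x ^^ j) c \<notin> G"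
    using succ_spec[OF assms(1)] assms(2,4) by (metis empty_iff)
  have a: "a \<in> incident G x" using succ_mem[OF assms(1) cB] assms(2,4) by blast
  then have "a \<in> incident B x" using incident_mono[OF assms(1)] by blast
  then obtain l where l: "0 < l" "succ G x a = (\<rho> x ^^ l) a" "(\<rho> x ^^ l) a \<in> G"
    "\<And>j. 0 < j \<Longrightarrow> j < l \<Longrightarrow> (\<rho> x ^^ j) a \<notin> G"
    using succ_spec[OF assms(1)] a by (metis empty_iff)
  have shift: "(\<rho> x ^^ (j + k)) c = (\<rho> x ^^ j) a" for j
    using k(2) by (simp add: funpow_add)
  \<comment> \<open>Otherwise \<open>a\<close> and \<open>c\<close> would have the same
    successor.\<close>
  have "succ G x a \<noteq> a" using succ_inj[OF assms(1,2) a] assms(3,4) by metis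
  have "succ (G - {a}) x c = (\<rho> x ^^ (l + k)) c"
  proof (rule succ_eqI)
    show "(\<rho> x ^^ (l + k)) c \<in> G - {a}" using l \<open>succ G x a \<noteq> a\<close> by (simp add: shift)
    fix j assume j: "0 < j" "j < l + k"
    consider "j < k" | "j = k" | "k < j" by linarith
    then show "(\<rho> x ^^ j) c \<notin> G - {a}"
    proof cases
      case 1 then show ?thesis using k j by simp
    next
      case 2 then show ?thesis using k by simp
    next
      case 3
      then have "(\<rho> x ^^ j) c = (\<rho> x ^^ (j - k)) a" using shift[of "j - k"] by simp
      then show ?thesis using l(4)[of "j - k"] 3 j by simp
    qed
  qed (use k in simp)
  then show ?thesis using l by (simp add: shift)
qed

section \<open>Darts and face tracing\<close>

definition opp :: "'v + 'e \<Rightarrow> 'v \<times> 'e \<Rightarrow> 'v + 'e" where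
  "opp z c = (if z = Inl (fst c) then Inr (snd c) else Inl (fst c))"

lemma opp_simps [simp]:
  "opp (Inl (fst c)) c = Inr (snd c)" "opp (Inr (snd c)) c = Inl (fst c)"
  by (auto simp: opp_def)

text \<open>A pair \<open>(z, c)\<close> stands for the edge \<open>c\<close> directed away from its endpoint \<open>z\<close>.\<close>
definition darts :: "('v \<times> 'e) set \<Rightarrow> (('v + 'e) \<times> ('v \<times> 'e)) set" where
  "darts G = {(z, c). c \<in> incident G z}"

text \<open>The face permutation of the ribbon graph: cross \<open>c\<close> and continue with the
  next edge at the far end. One traversal step of the process applies it twice, from an emerald end
  to the violet end and on to the next emerald end.\<close>

definition face :: "('v \<times> 'e) set \<Rightarrow> ('v + 'e) \<times> ('v \<times> 'e) \<Rightarrow> ('v + 'e) \<times> ('v \<times> 'e)" where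
  "face G = (\<lambda>(z, c). (opp z c, succ G (opp z c) c))"

lemma darts_iff: "(z, c) \<in> darts G \<longleftrightarrow> c \<in> G \<and> (z = Inl (fst c) \<or> z = Inr (snd c))"
  by (auto simp: darts_def incident_def)

lemma dart_node:
  assumes "(z, c) \<in> darts G" "G \<subseteq> V \<times> E"
  shows "z \<in> V <+> E"
proof -
  have "c \<in> V \<times> E" using assms by (auto simp: darts_iff)
  then show ?thesis using assms(1) by (auto simp: darts_iff)
qed

lemma opp_dart: "(z, c) \<in> darts G \<Longrightarrow> (opp z c, c) \<in> darts G \<and> opp (opp z c) c = z"
  by (auto simp: darts_iff)

lemma finite_darts: "G \<subseteq> B \<Longrightarrow> finite (darts G)"
proof -
  assume "G \<subseteq> B"
  then have "finite G" using B_sub finite_edges by blast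
  moreover have "darts G = (\<lambda>c. (Inl (fst c), c)) ` G \<union> (\<lambda>c. (Inr (snd c), c)) ` G"
    by (auto simp: darts_iff image_iff)
  ultimately show ?thesis by simp
qed

lemma face_dart:
  assumes "G \<subseteq> B" "p \<in> darts G"
  shows "face G p \<in> darts G"
proof -
  obtain z c where p: "p = (z, c)" by (cases p)
  have "c \<in> incident G (opp z c)" using opp_dart assms p by (auto simp: darts_def)
  then have "succ G (opp z c) c \<in> incident G (opp z c)"
    using succ_mem[OF assms(1), of c "opp z c"] incident_mono[OF assms(1)] by blast
  then show ?thesis by (simp add: p face_def darts_def)
qed

lemma face_inj: "G \<subseteq> B \<Longrightarrow> inj_on (face G) (darts G)"
proof (rule inj_onI)
  fix p q assume G: "G \<subseteq> B" and "p \<in> darts G" "q \<in> darts G" and e: "face G p = face G q"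
  obtain z c z' c' where p: "p = (z, c)" and q: "q = (z', c')" by (cases p, cases q)
  have pq: "(z, c) \<in> darts G" "(z', c') \<in> darts G" using \<open>p \<in> _\<close> \<open>q \<in> _\<close> p q by simp_all
  have o: "opp z c = opp z' c'" and s: "succ G (opp z c) c = succ G (opp z c) c'"
    using e by (auto simp: face_def p q)
  have "c \<in> incident G (opp z c)" "c' \<in> incident G (opp z c)"
    using opp_dart[OF pq(1)] opp_dart[OF pq(2)] o by (auto simp: darts_def)
  then have "c = c'" using succ_inj[OF G] s by blast
  then show "p = q" using opp_dart[OF pq(1)] opp_dart[OF pq(2)] o p q by metis
qed

lemma hypertree_connected:
  assumes "f \<in> hypertrees V E G"
  shows "connected_graph (V <+> E) G"
proof -
  obtain T where "T \<subseteq> G" "connected_graph (V <+> E) T"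
    using assms by (auto simp: hypertrees_def spanning_tree_def)
  then show ?thesis using conn_mono[of T G] by (auto simp: connected_graph_def)
qed

lemma incident_nonempty:
  assumes "connected_graph (V <+> E) G" "z \<in> V <+> E"
  shows "incident G z \<noteq> {}"
proof -
  obtain v e where ve: "v \<in> V" "e \<in> E" using V_nonempty E_nonempty by blast
  obtain y where "y \<in> V <+> E" "z \<noteq> y"
  proof (cases z)
    case (Inl u) then show ?thesis using that[of "Inr e"] ve by auto
  next
    case (Inr u) then show ?thesis using that[of "Inl v"] ve by auto
  qed
  then obtain y where "(z, y) \<in> adj G" using connected_adj_ex[OF assms] by blast
  then show ?thesis by (auto simp: adj_def incident_def)
qed

lemma simple_path_not_edge:
  assumes "distinct xs" "xs \<noteq> []" "successively (\<lambda>x y. (x, y) \<in> r) xs"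
    and "hd xs \<noteq> last xs" "(hd xs, last xs) \<notin> r"
  shows "length xs \<ge> 3"
proof (cases xs)
  case (Cons x ys)
  then show ?thesis
  proof (cases ys)
    case (Cons y zs)
    then show ?thesis using assms \<open>xs = x # ys\<close> by (cases zs) auto
  qed (use assms in auto)
qed (use assms in auto)

text \<open>A closed walk leaving an emerald node along a forced edge has to come back along the same
  edge, since a simple directed cycle would contradict \<open>no_forced_cycle\<close>. Hence \<open>Z\<close> is closed under
  reversal, thus under the cyclic order at every node.\<close>
lemma face_closed_all_darts:
  assumes GB: "G \<subseteq> B" and f: "f \<in> hypertrees V E G"
    and Z: "Z \<subseteq> darts G" "Z \<noteq> {}" "face G ` Z \<subseteq> Z"
    and forced: "\<And>e c. (Inr e, c) \<in> Z \<Longrightarrow> f \<notin> hypertrees V E (G - {c})"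
  shows "Z = darts G"
proof -
  have GV: "G \<subseteq> V \<times> E" using GB B_sub by blast
  define r where "r = {(z, opp z c) | z c. (z, c) \<in> Z}"
  have r_adj: "r \<subseteq> adj G"
  proof clarify
    fix z y assume "(z, y) \<in> r"
    then obtain c where "(z, c) \<in> darts G" "y = opp z c" using Z(1) by (auto simp: r_def)
    then show "(z, y) \<in> adj G" by (auto simp: darts_iff adj_iff)
  qed
  have r_forced: "f \<notin> hypertrees V E (G - {(v, e)})" if ev: "(Inr e, Inl v) \<in> r" for v e
  proof -
    obtain c where c: "(Inr e, c) \<in> Z" "Inl v = opp (Inr e) c" using ev unfolding r_def by blast
    then have "(Inr e, c) \<in> darts G" using Z(1) by blast
    then have "c = (v, e)" using c(2) by (cases c) (auto simp: darts_iff opp_def)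
    then show ?thesis using forced c by blast
  qed
  have fin: "finite Z" using finite_subset[OF Z(1) finite_darts[OF GB]] .
  have inj: "inj_on (face G) Z" using inj_on_subset[OF face_inj[OF GB] Z(1)] .
  have walk: "(fst p, fst ((face G ^^ m) p)) \<in> r\<^sup>*" if "p \<in> Z" for p m
    using that
  proof (induction m arbitrary: p)
    case (Suc m)
    have "(fst p, fst (face G p)) \<in> r" using Suc.prems by (cases p) (auto simp: r_def face_def)
    moreover have "(fst (face G p), fst ((face G ^^ m) (face G p))) \<in> r\<^sup>*"
      using Suc Z(3) by blast
    ultimately show ?case
      unfolding funpow_Suc_right comp_apply by (rule converse_rtrancl_into_rtrancl)
  qed simp
  have rev: "(opp z c, c) \<in> Z" if zc: "(z, c) \<in> Z" for z c
  proof (rule ccontr)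
    assume n: "(opp z c, c) \<notin> Z"
    obtain k where k: "0 < k" "(face G ^^ k) (z, c) = (z, c)"
      using funpow_return[OF fin Z(3) inj zc] by blast
    have "(face G ^^ (k - 1)) (face G (z, c)) = (z, c)"
      using k by (metis Suc_diff_1 comp_apply funpow_Suc_right)
    moreover have "face G (z, c) \<in> Z" using zc Z(3) by blast
    ultimately have "(fst (face G (z, c)), z) \<in> r\<^sup>*" using walk[of "face G (z, c)" "k - 1"] by simp
    then have "(opp z c, z) \<in> r\<^sup>*" by (simp add: face_def)
    then obtain xs where xs: "distinct xs" "xs \<noteq> []" "hd xs = opp z c" "last xs = z"
      "successively (\<lambda>a b. (a, b) \<in> r) xs" by (rule simple_path_ex)
    have zd: "(z, c) \<in> darts G" using zc Z(1) by blast
    \<comment> \<open>The two nodes determine the edge, so such a dart would be the missing reversal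
      of \<open>(z, c)\<close>.\<close>
    have "(opp z c, z) \<notin> r"
    proof
      assume "(opp z c, z) \<in> r"
      then obtain c' where c': "(opp z c, c') \<in> Z" "z = opp (opp z c) c'" by (auto simp: r_def)
      then have "(opp z c, c') \<in> darts G" using Z(1) by blast
      then have "c' = c" using c'(2) zd by (cases c; cases c') (auto simp: darts_iff opp_def split: if_splits)
      then show False using c' n by simp
    qed
    moreover have "opp z c \<noteq> z" using zd by (auto simp: darts_iff)
    ultimately have "length xs \<ge> 3" using simple_path_not_edge[OF xs(1,2,5)] xs by simp
    moreover have "(last xs, hd xs) \<in> r" using zc unfolding xs(3,4) r_def by blast
    ultimately show False
      using no_forced_cycle[OF GV f xs(1) _ _ r_adj r_forced] cyclic_list_of_path[OF xs(5,2)] by blast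
  qed
  \<comment> \<open>The face map sends the reversal of \<open>(z, c)\<close> to the next dart at
    \<open>z\<close>, so one dart at \<open>z\<close> brings all of them into
    \<open>Z\<close>.\<close>
  have full: "c \<in> incident G z \<Longrightarrow> (z, c) \<in> Z" if zd: "(z, d) \<in> Z" for z c d
  proof -
    have "incident G z \<subseteq> {c. (z, c) \<in> Z}"
    proof (rule succ_closed[OF GB])
      show "d \<in> incident G z" using zd Z(1) by (auto simp: darts_def)
      show "d \<in> {c. (z, c) \<in> Z}" using zd by simp
      fix c assume "c \<in> {c. (z, c) \<in> Z}"
      then have zc: "(z, c) \<in> Z" by simp
      have "opp (opp z c) c = z" using opp_dart zc Z(1) by blast
      then have "face G (opp z c, c) = (z, succ G z c)" by (simp add: face_def)
      then show "succ G z c \<in> {c. (z, c) \<in> Z}" using rev[OF zc] Z(3) by (metis imageI mem_Collect_eq subsetD)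
    qed
    then show "c \<in> incident G z \<Longrightarrow> (z, c) \<in> Z" by blast
  qed
  have nbr: "\<exists>c. (y, c) \<in> Z" if z: "\<exists>c. (z, c) \<in> Z" and zy: "(z, y) \<in> adj G" for z y
  proof -
    obtain c where c: "c \<in> incident G z" "y = opp z c"
      using zy by (rule adjE) (force simp: incident_def opp_def)+
    then have "(z, c) \<in> Z" using full z by blast
    then show ?thesis using rev c by blast
  qed
  show ?thesis
  proof (rule equalityI[OF Z(1)], clarify)
    fix z c assume zc: "(z, c) \<in> darts G"
    obtain z0 c0 where z0: "(z0, c0) \<in> Z" using Z(2) by auto
    have "(z0, c0) \<in> darts G" using z0 Z(1) by blast
    then have "z0 \<in> V <+> E" "z \<in> V <+> E" using dart_node zc GV by blast+
    then have "(z0, z) \<in> (adj G)\<^sup>*" using hypertree_connected[OF f] by (simp add: connected_graph_def)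
    then have "\<exists>d. (z, d) \<in> Z"
      by (induction rule: rtrancl_induct) (use z0 nbr in blast)+
    moreover have "c \<in> incident G z" using zc by (simp add: darts_def)
    ultimately show "(z, c) \<in> Z" using full by blast
  qed
qed

text \<open>The dart of the current edge at its emerald end is pending: it is the only place at
  which the face walk through \<open>R\<close> may leave \<open>R\<close>. Forcedness refers to the
  current graph and persists when this graph shrinks.\<close>

fun good_state :: "('e \<Rightarrow> int) \<Rightarrow> ('v, 'e) state \<Rightarrow> bool" where
  "good_state f (G, a, R) \<longleftrightarrow> G \<subseteq> B \<and> f \<in> hypertrees V E G \<and> a \<in> G \<and> R \<subseteq> darts G \<and>
     (\<forall>e c. (Inr e, c) \<in> R \<longrightarrow> f \<notin> hypertrees V E (G - {c})) \<and>
     face G ` R \<subseteq> insert (Inr (snd a), a) R"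

text \<open>Removing the only edge at an emerald node would isolate the node.\<close>

lemma succ_neq_if_removable:
  assumes GB: "G \<subseteq> B" and a: "a \<in> G" and rem: "f \<in> hypertrees V E (G - {a})"
  shows "succ G (Inr (snd a)) a \<noteq> a"
proof
  assume s: "succ G (Inr (snd a)) a = a"
  have "incident G (Inr (snd a)) \<subseteq> {a}"
    by (rule succ_closed[OF GB, of a]) (use a s in \<open>auto simp: incident_def\<close>)
  then have "incident (G - {a}) (Inr (snd a)) = {}" by (auto simp: incident_def)
  moreover have "Inr (snd a) \<in> V <+> E" using a GB B_sub by auto
  ultimately show False using incident_nonempty[OF hypertree_connected[OF rem]] by blast
qed

text \<open>Otherwise the part of the walk after the traversal of \<open>a\<close> would be a closed face of \<open>G - {a}\<close>,
  hence all of \<open>G - {a}\<close> would consist of forced edges, although it connects the endpoints of \<open>a\<close>.\<close>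
lemma removed_not_traversed:
  assumes g: "good_state f (G, a, R)" and rem: "f \<in> hypertrees V E (G - {a})"
  shows "(z, a) \<notin> R"
proof
  let ?x = "Inl (fst a)" and ?y = "Inr (snd a)" and ?G = "G - {a}"
  have GB: "G \<subseteq> B" and f: "f \<in> hypertrees V E G" and a: "a \<in> G" and R: "R \<subseteq> darts G"
    and forced: "\<And>e c. (Inr e, c) \<in> R \<Longrightarrow> f \<notin> hypertrees V E (G - {c})"
    and face: "face G ` R \<subseteq> insert (?y, a) R"
    using g by auto
  have GV: "G \<subseteq> V \<times> E" using GB B_sub by blast
  have y: "(?y, a) \<notin> R" using forced rem by blast
  assume "(z, a) \<in> R"
  then have xR: "(?x, a) \<in> R" using y R by (auto simp: darts_iff)
  let ?p = "(?x, a)"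
  have pd: "?p \<in> darts G" using a by (simp add: darts_iff)
  \<comment> \<open>The face walk from the traversed dart is followed until it returns there or
    leaves \<open>R\<close>. It can leave \<open>R\<close> only at the pending dart.\<close>
  define P where "P n \<longleftrightarrow> 0 < n \<and> ((face G ^^ n) ?p = ?p \<or> (face G ^^ n) ?p \<notin> R)" for n
  obtain m where "0 < m" "(face G ^^ m) ?p = ?p"
    using funpow_return[OF finite_darts[OF GB] _ face_inj[OF GB] pd] face_dart[OF GB] by blast
  then have "P m" by (simp add: P_def)
  define n where "n = (LEAST n. P n)"
  have Pn: "P n" unfolding n_def using \<open>P m\<close> by (rule LeastI)
  have less: "\<not> P i" if "i < n" for i using that not_less_Least unfolding n_def by blast
  have inR: "(face G ^^ i) ?p \<in> R" if "i < n" for i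
    using less[OF that] xR by (cases "i = 0") (auto simp: P_def)
  have n0: "0 < n" using Pn by (simp add: P_def)
  show False
  proof (cases "(face G ^^ n) ?p = ?p")
    case True
    \<comment> \<open>Returning inside \<open>R\<close> gives a complete face of \<open>G\<close>,
      hence all darts, including the untraversed one at \<open>?y\<close>.\<close>
    let ?Z = "(\<lambda>i. (face G ^^ i) ?p) ` {..<n}"
    have ZR: "?Z \<subseteq> R" using inR by auto
    have "?Z = darts G"
    proof (rule face_closed_all_darts[OF GB f])
      show "?Z \<subseteq> darts G" using ZR R by blast
      show "?Z \<noteq> {}" using n0 by auto
      show "face G ` ?Z \<subseteq> ?Z"
      proof (rule image_subsetI)
        fix q assume "q \<in> ?Z"
        then obtain i where i: "i < n" "q = (face G ^^ i) ?p" by auto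
        show "face G q \<in> ?Z"
        proof (cases "Suc i = n")
          case True
          then have "face G q = (face G ^^ 0) ?p"
            using i \<open>(face G ^^ n) ?p = ?p\<close> by auto
          then show ?thesis using n0 by blast
        next
          case False
          then have "Suc i \<in> {..<n}" using i by simp
          moreover have "face G q = (face G ^^ Suc i) ?p" using i by simp
          ultimately show ?thesis by blast
        qed
      qed
      show "f \<notin> hypertrees V E (G - {c})" if "(Inr e, c) \<in> ?Z" for e c
        using that ZR forced by blast
    qed
    moreover have "(?y, a) \<in> darts G" using a by (simp add: darts_iff)
    ultimately show ?thesis using ZR y by blast
  next
    case False
    then have "(face G ^^ n) ?p \<notin> R" using Pn by (simp add: P_def)
    moreover have "(face G ^^ n) ?p \<in> insert (?y, a) R"
    proof -
      have "(face G ^^ n) ?p = face G ((face G ^^ (n - 1)) ?p)"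
        using n0 by (metis Suc_diff_1 comp_apply funpow.simps(2))
      then show ?thesis using inR[of "n - 1"] n0 face by auto
    qed
    ultimately have ny: "(face G ^^ n) ?p = (?y, a)" by blast
    have f1: "face G ?p = (?y, succ G ?y a)" by (simp add: face_def)
    have "n \<noteq> 1" using ny f1 succ_neq_if_removable[OF GB a rem] by auto
    then have n1: "1 < n" using n0 by simp
    let ?Z = "(\<lambda>i. (face G ^^ i) ?p) ` {1..<n}"
    have ZR: "?Z \<subseteq> R" using inR by auto
    have Za: "c \<noteq> a" if wc: "(w, c) \<in> ?Z" for w c
    proof
      assume "c = a"
      obtain i where i: "(w, c) = (face G ^^ i) ?p" "1 \<le> i" "i < n" using wc by auto
      then have "(face G ^^ i) ?p \<noteq> ?p" using less[of i] by (auto simp: P_def)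
      then have "w \<noteq> ?x" using i \<open>c = a\<close> by auto
      moreover have "(w, c) \<in> R" using wc ZR by blast
      ultimately show False using y R \<open>c = a\<close> by (auto simp: darts_iff)
    qed
    have G'B: "?G \<subseteq> B" using GB by blast
    have Zall: "?Z = darts ?G"
    proof (rule face_closed_all_darts[OF G'B rem])
      show "?Z \<subseteq> darts ?G"
      proof (rule subrelI)
        fix w c assume "(w, c) \<in> ?Z"
        then have "(w, c) \<in> darts G" "c \<noteq> a" using ZR R Za by blast+
        then show "(w, c) \<in> darts ?G" by (simp add: darts_iff)
      qed
      show "?Z \<noteq> {}" using n1 by auto
      show "f \<notin> hypertrees V E (?G - {c})" if "(Inr e, c) \<in> ?Z" for e c
      proof -
        have "f \<notin> hypertrees V E (G - {c})" using that ZR forced by blast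
        moreover have "?G - {c} \<subseteq> G - {c}" by blast
        ultimately show ?thesis using hypertrees_mono by blast
      qed
      show "face ?G ` ?Z \<subseteq> ?Z"
      proof (rule image_subsetI)
        fix q assume q: "q \<in> ?Z"
        obtain i where i: "q = (face G ^^ i) ?p" "1 \<le> i" "i < n" using q by auto
        obtain w c where wc: "q = (w, c)" by (cases q)
        have ca: "c \<noteq> a" using Za[of w c] q unfolding wc by simp
        have qR: "(w, c) \<in> R" using q ZR unfolding wc by (rule rev_subsetD)
        then have "(w, c) \<in> darts G" using R by blast
        then have cG: "c \<in> incident G (opp w c)" using opp_dart by (auto simp: darts_def)
        have fq: "face G q = (face G ^^ Suc i) ?p" using i by simp
        show "face ?G q \<in> ?Z"
        proof (cases "succ G (opp w c) c = a")
          case True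
          then have fqa: "face G q = (opp w c, a)" by (simp add: face_def wc)
          have "opp w c \<noteq> ?x"
          proof
            assume "opp w c = ?x"
            then have e: "(face G ^^ Suc i) ?p = ?p" using fqa fq by simp
            show False
            proof (cases "Suc i = n")
              case True then show ?thesis using e ny by simp
            next
              case False then show ?thesis using e less[of "Suc i"] i by (simp add: P_def)
            qed
          qed
          moreover have "face G q \<in> insert (?y, a) R" using qR face wc by blast
          ultimately have "opp w c = ?y" using fqa R by (auto simp: darts_iff)
          \<comment> \<open>In \<open>G - {a}\<close> the dart that led to the pending one is
            followed by the successor of \<open>a\<close> at \<open>?y\<close>, where
            \<open>?Z\<close> begins. This closes the walk.\<close>
          moreover have "succ ?G (opp w c) c = succ G (opp w c) a"
            using succ_delete[OF GB cG ca True] .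
          ultimately have "face ?G q = (face G ^^ 1) ?p" by (simp add: face_def wc f1)
          then show ?thesis using n1 by (metis atLeastLessThan_iff imageI order_refl)
        next
          case False
          then have eq: "face ?G q = face G q"
            using succ_delete_other[OF GB cG False] by (simp add: face_def wc)
          have "Suc i \<noteq> n"
          proof
            assume "Suc i = n"
            then have "face G q = (?y, a)" using fq ny by simp
            then show False using False by (simp add: face_def wc)
          qed
          then have "Suc i \<in> {1..<n}" using i by simp
          then show ?thesis using eq fq by (metis imageI)
        qed
      qed
    qed
    \<comment> \<open>The edge \<open>a\<close> is added only in the direction from violet to
      emerald, which carries no forcedness condition. A path back through \<open>G - {a}\<close>
      completes a forbidden cycle.\<close>
    define r where "r = insert (?x, ?y) (adj ?G)"
    have "?x \<in> V <+> E" "?y \<in> V <+> E" using a GV by auto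
    then have "(?y, ?x) \<in> (adj ?G)\<^sup>*"
      using hypertree_connected[OF rem] by (simp add: connected_graph_def)
    then obtain xs where xs: "distinct xs" "xs \<noteq> []" "hd xs = ?y" "last xs = ?x"
      "successively (\<lambda>a b. (a, b) \<in> adj ?G) xs" by (rule simple_path_ex)
    have "length xs \<ge> 3"
      by (rule simple_path_not_edge[OF xs(1,2,5)]) (use xs in \<open>auto simp: adj_iff\<close>)
    moreover have sr: "successively (\<lambda>a b. (a, b) \<in> r) xs"
      using xs(5) by (rule successively_mono) (auto simp: r_def)
    moreover have lr: "(last xs, hd xs) \<in> r" using xs by (simp add: r_def)
    moreover have "r \<subseteq> adj G" using a adj_mono[of ?G G] by (auto simp: r_def adj_iff)
    moreover have "f \<notin> hypertrees V E (G - {(v, e)})" if "(Inr e, Inl v) \<in> r" for v e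
    proof -
      have "(v, e) \<in> ?G" using that unfolding r_def by (simp add: adj_iff)
      then have "(Inr e, (v, e)) \<in> ?Z" unfolding Zall by (simp add: darts_iff)
      then show ?thesis using ZR forced by blast
    qed
    ultimately show False
      using no_forced_cycle[OF GV f xs(1)] cyclic_list_of_path[OF sr xs(2) lr] by blast
  qed
qed

lemma good_state_init:
  assumes "f \<in> hypertrees V E B" "b \<in> incident B b0"
  shows "good_state f (bernardi_init B \<rho> b0 b)"
proof (cases b0)
  case (Inr e)
  then show ?thesis using assms by (auto simp: bernardi_init_def incident_def)
next
  case (Inl v)
  let ?y = "Inr (snd b)" and ?c = "succ B (Inr (snd b)) b"
  have b: "b \<in> B" "v = fst b" using assms Inl by (auto simp: incident_def)
  then have "b \<in> incident B ?y" by (simp add: incident_def)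
  then have "?c \<in> incident B ?y" by (intro succ_mem) auto
  then have c: "?c \<in> B" "snd ?c = snd b" by (auto simp: incident_def)
  have "face B (Inl v, b) = (Inr (snd ?c), ?c)" using b c by (simp add: face_def)
  then show ?thesis using assms b c Inl by (auto simp: bernardi_init_def darts_iff)
qed

text \<open>On a removal, \<open>removed_not_traversed\<close> keeps \<open>R\<close> inside the
  graph, and a dart that led to the removed edge now leads to the new current one. A traversal
  appends two consecutive darts of the face walk.\<close>

lemma good_state_step:
  assumes g: "good_state f s" and st: "bernardi_step V E \<rho> f s = Some s'"
  shows "good_state f s'"
proof -
  obtain G a R where s: "s = (G, a, R)" by (cases s) auto
  let ?x = "Inl (fst a)" and ?y = "Inr (snd a)" and ?G = "G - {a}"
  have GB: "G \<subseteq> B" and f: "f \<in> hypertrees V E G" and a: "a \<in> G" and R: "R \<subseteq> darts G"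
    and forced: "\<And>e c. (Inr e, c) \<in> R \<Longrightarrow> f \<notin> hypertrees V E (G - {c})"
    and face: "face G ` R \<subseteq> insert (?y, a) R"
    using g unfolding s by auto
  have inc: "a \<in> incident B ?y" "a \<in> incident G ?y" "a \<in> incident B ?x" "a \<in> incident G ?x"
    using a GB by (auto simp: incident_def)
  show ?thesis
  proof (cases "f \<in> hypertrees V E ?G")
    case True
    have s': "s' = (?G, succ G ?y a, R)" using st True by (simp add: bernardi_step_def s)
    have nR: "(z, a) \<notin> R" for z using removed_not_traversed[OF _ True] g s by blast
    have "succ G ?y a \<in> incident G ?y" by (rule succ_mem) (use inc GB in auto)
    then have c: "succ G ?y a \<in> ?G" "snd (succ G ?y a) = snd a"
      using succ_neq_if_removable[OF GB a True] by (auto simp: incident_def)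
    have "R \<subseteq> darts ?G"
    proof (rule subrelI)
      fix z c assume "(z, c) \<in> R"
      then have "(z, c) \<in> darts G" "c \<noteq> a" using nR R by blast+
      then show "(z, c) \<in> darts ?G" by (simp add: darts_iff)
    qed
    moreover have "f \<notin> hypertrees V E (?G - {c})" if "(Inr e, c) \<in> R" for e c
    proof -
      have "?G - {c} \<subseteq> G - {c}" by blast
      then show ?thesis using forced[OF that] hypertrees_mono by blast
    qed
    moreover have "face ?G ` R \<subseteq> insert (?y, succ G ?y a) R"
    proof (rule image_subsetI)
      fix q assume q: "q \<in> R"
      obtain w c where wc: "q = (w, c)" by (cases q)
      have ca: "c \<noteq> a" using nR q wc by blast
      have "(w, c) \<in> darts G" using q wc R by blast
      then have cG: "c \<in> incident G (opp w c)" using opp_dart by (auto simp: darts_def)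
      have fq: "face G q \<in> insert (?y, a) R" using q face by blast
      show "face ?G q \<in> insert (?y, succ G ?y a) R"
      proof (cases "succ G (opp w c) c = a")
        case True
        then have "face G q = (opp w c, a)" by (simp add: face_def wc)
        then have "opp w c = ?y" using fq nR by auto
        then show ?thesis using succ_delete[OF GB cG ca True] by (simp add: face_def wc)
      next
        case False
        then have "face ?G q = face G q"
          using succ_delete_other[OF GB cG False] by (simp add: face_def wc)
        moreover have "face G q \<noteq> (?y, a)" using False by (simp add: face_def wc)
        ultimately show ?thesis using fq by simp
      qed
    qed
    ultimately show ?thesis using True c GB by (simp add: s') blast
  next
    case False
    let ?c = "succ G ?x a"
    let ?d = "succ G (Inr (snd ?c)) ?c"
    have s': "s' = (G, ?d, R \<union> {(?y, a), (?x, ?c)})"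
      using st False by (auto simp: bernardi_step_def s Let_def split: if_splits)
    have "?c \<in> incident G ?x" by (rule succ_mem) (use inc GB in auto)
    then have c: "?c \<in> G" "fst ?c = fst a" by (auto simp: incident_def)
    then have ci: "?c \<in> incident G (Inr (snd ?c))" by (simp add: incident_def)
    then have "?d \<in> incident G (Inr (snd ?c))"
      by (intro succ_mem[OF GB]) (use incident_mono[OF GB] in auto)
    then have d: "?d \<in> G" "snd ?d = snd ?c" by (auto simp: incident_def)
    have "face G (?y, a) = (?x, ?c)" by (simp add: face_def)
    moreover have "face G (?x, ?c) = (Inr (snd ?d), ?d)"
    proof -
      have "opp ?x ?c = Inr (snd ?c)" using c(2) opp_simps(1)[of ?c] by simp
      then show ?thesis using d by (simp add: face_def)
    qed
    ultimately have "face G ` (R \<union> {(?y, a), (?x, ?c)}) \<subseteq> insert (Inr (snd ?d), ?d) (R \<union> {(?y, a), (?x, ?c)})"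
      using face by auto
    moreover have "R \<union> {(?y, a), (?x, ?c)} \<subseteq> darts G" using R a c by (auto simp: darts_iff)
    moreover have "\<forall>e c. (Inr e, c) \<in> R \<union> {(?y, a), (?x, ?c)} \<longrightarrow> f \<notin> hypertrees V E (G - {c})"
      using forced False by blast
    ultimately show ?thesis using GB f d(1) unfolding s' good_state.simps by blast
  qed
qed

text \<open>Stopping means that the face walk runs into itself, so \<open>R\<close> with the pending
  dart is closed under \<open>face\<close> and fills the graph.\<close>

lemma good_state_stop:
  assumes g: "good_state f (G, a, R)" and st: "bernardi_step V E \<rho> f (G, a, R) = None"
  shows "darts G \<subseteq> insert (Inr (snd a), a) R"
proof -
  let ?x = "Inl (fst a)" and ?y = "Inr (snd a)"
  have GB: "G \<subseteq> B" and f: "f \<in> hypertrees V E G" and a: "a \<in> G" and R: "R \<subseteq> darts G"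
    and forced: "\<And>e c. (Inr e, c) \<in> R \<Longrightarrow> f \<notin> hypertrees V E (G - {c})"
    and face: "face G ` R \<subseteq> insert (?y, a) R"
    using g by auto
  have nr: "f \<notin> hypertrees V E (G - {a})" and "(?y, a) \<in> R \<or> (?x, succ G ?x a) \<in> R"
    using st by (auto simp: bernardi_step_def Let_def split: if_splits)
  moreover have "face G (?y, a) = (?x, succ G ?x a)" by (simp add: face_def)
  ultimately have "face G ` insert (?y, a) R \<subseteq> insert (?y, a) R" using face by auto
  moreover have "insert (?y, a) R \<subseteq> darts G" using R a by (auto simp: darts_iff)
  moreover have "f \<notin> hypertrees V E (G - {c})" if "(Inr e, c) \<in> insert (?y, a) R" for e c
    using that forced[of e c] nr by blast
  ultimately have "insert (?y, a) R = darts G"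
    using face_closed_all_darts[OF GB f, of "insert (?y, a) R"] by blast
  then show ?thesis by simp
qed

end

section \<open>The Bernardi process\<close>

definition key_list :: "'e set \<Rightarrow> ('e \<Rightarrow> nat) \<Rightarrow> 'e list" where
  "key_list E t = map (inv_into E t) (sorted_list_of_set (t ` E))"

lemma key_list:
  assumes "finite E" "inj_on t E"
  shows "distinct (key_list E t)" "set (key_list E t) = E" "sorted_wrt (\<lambda>x y. t x < t y) (key_list E t)"
proof -
  have fin: "finite (t ` E)" using assms by simp
  show "distinct (key_list E t)"
    unfolding key_list_def distinct_map using fin
    by (auto intro: inj_on_inv_into)
  show "set (key_list E t) = E"
    unfolding key_list_def using fin assms(2) by (simp add: inv_into_image_cancel)
  have "sorted_wrt (\<lambda>x y. t (inv_into E t x) < t (inv_into E t y)) (sorted_list_of_set (t ` E))"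
    by (rule sorted_wrt_mono_rel[OF _ strict_sorted_list_of_set])
       (use fin in \<open>auto simp: f_inv_into_f\<close>)
  then show "sorted_wrt (\<lambda>x y. t x < t y) (key_list E t)"
    by (simp add: key_list_def sorted_wrt_map)
qed

lemma filter_le_sorted:
  fixes t :: "'e \<Rightarrow> nat"
  assumes "sorted_wrt (\<lambda>x y. t x < t y) xs"
  shows "filter (\<lambda>e. t e \<le> \<tau>) xs = take (length (filter (\<lambda>e. t e \<le> \<tau>) xs)) xs"
  using assms
proof (induction xs)
  case (Cons x xs)
  show ?case
  proof (cases "t x \<le> \<tau>")
    case True
    then show ?thesis using Cons by simp
  next
    case False
    then have "filter (\<lambda>e. t e \<le> \<tau>) (x # xs) = []" using Cons.prems by (auto simp: filter_empty_conv)
    then show ?thesis by simp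
  qed
qed simp

lemma filter_nth_sorted:
  fixes t :: "'e \<Rightarrow> nat"
  assumes s: "sorted_wrt (\<lambda>x y. t x < t y) xs" and k: "k < length xs"
  shows "filter (\<lambda>e. t e \<le> t (xs ! k)) xs = take (Suc k) xs"
proof -
  have lt: "t (xs ! i) < t (xs ! j)" if "i < j" "j < length xs" for i j
    using s that by (simp add: sorted_wrt_iff_nth_less)
  have "filter (\<lambda>e. t e \<le> t (xs ! k)) (take (Suc k) xs) = take (Suc k) xs"
  proof (rule filter_True, rule ballI)
    fix x assume "x \<in> set (take (Suc k) xs)"
    then obtain i where "i < Suc k" "x = xs ! i" using k by (auto simp: in_set_conv_nth)
    then show "t x \<le> t (xs ! k)" using lt[of i k] k by (cases "i = k") auto
  qed
  moreover have "filter (\<lambda>e. t e \<le> t (xs ! k)) (drop (Suc k) xs) = []"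
  proof (rule filter_False, rule ballI)
    fix x assume "x \<in> set (drop (Suc k) xs)"
    then obtain i where "i < length (drop (Suc k) xs)" "x = drop (Suc k) xs ! i"
      by (metis in_set_conv_nth)
    then have "Suc k + i < length xs" "x = xs ! (Suc k + i)" by simp_all
    then show "\<not> t x \<le> t (xs ! k)" using lt[of k "Suc k + i"] by simp
  qed
  ultimately show ?thesis
    by (metis append_Nil2 append_take_drop_id filter_append)
qed

text \<open>Below the threshold both listings sort the same elements by the same keys. The threshold
  is the key of entry \<open>k\<close>, counted from zero, which gives \<open>Suc k\<close>
  entries.\<close>

lemma take_key_list_eq:
  fixes s t :: "'e \<Rightarrow> nat"
  assumes fin: "finite E" and inj: "inj_on s E" "inj_on t E" and k: "k < card E"
    and \<tau>: "\<tau> = s (key_list E s ! k)"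
    and agree: "\<And>e. e \<in> E \<Longrightarrow> s e \<le> \<tau> \<or> t e \<le> \<tau> \<Longrightarrow> s e = t e"
  shows "take (Suc k) (key_list E t) = take (Suc k) (key_list E s)"
proof -
  let ?S = "key_list E s" and ?T = "key_list E t"
  note S = key_list[OF fin inj(1)] and T = key_list[OF fin inj(2)]
  let ?s = "filter (\<lambda>e. s e \<le> \<tau>) ?S" and ?t = "filter (\<lambda>e. t e \<le> \<tau>) ?T"
  have kl: "k < length ?S" using k S(1,2) distinct_card by metis
  have s: "?s = take (Suc k) ?S" using filter_nth_sorted[OF S(3) kl] \<tau> by simp
  have "s e \<le> \<tau> \<longleftrightarrow> t e \<le> \<tau>" if "e \<in> E" for e using agree[OF that] by auto
  then have set: "set ?s = set ?t" using S(2) T(2) by auto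
  have st: "s e = t e" if "e \<in> set ?t" for e
    using agree[of e] that T(2) by auto
  have "map s ?s = map t ?t"
  proof (rule sorted_distinct_set_unique)
    have "sorted_wrt (<) (map s ?s)" "sorted_wrt (<) (map t ?t)"
      using S(3) T(3) by (simp_all add: sorted_wrt_map sorted_wrt_filter)
    then show "sorted (map s ?s)" "distinct (map s ?s)" "sorted (map t ?t)" "distinct (map t ?t)"
      by (simp_all only: strict_sorted_iff)
    have "s ` set ?t = t ` set ?t" using st by (intro image_cong refl)
    then show "set (map s ?s) = set (map t ?t)" using set by simp
  qed
  moreover have "map t ?t = map s ?t" using st by (intro map_cong) simp_all
  ultimately have "map s ?s = map s ?t" by simp
  moreover have "inj_on s (set ?s \<union> set ?t)"
    by (rule inj_on_subset[OF inj(1)]) (use S(2) T(2) in auto)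
  ultimately have eq: "?s = ?t" using inj_on_map_eq_map by blast
  moreover have "?t = take (length ?t) ?T" by (rule filter_le_sorted[OF T(3)])
  moreover have "length ?s = Suc k" using s kl by simp
  ultimately show ?thesis using s by metis
qed

section \<open>Visit times of a run\<close>

locale bernardi_run = ribbon_graph V E B \<rho>
  for V :: "'v set" and E :: "'e set" and B :: "('v \<times> 'e) set"
    and \<rho> :: "'v + 'e \<Rightarrow> 'v \<times> 'e \<Rightarrow> 'v \<times> 'e" +
  fixes b0 :: "'v + 'e" and b :: "'v \<times> 'e"
  assumes base: "b \<in> incident B b0"
begin

abbreviation state_at :: "('e \<Rightarrow> int) \<Rightarrow> nat \<Rightarrow> ('v, 'e) state option" where
  "state_at \<equiv> bernardi_state V E B \<rho> b0 b"

abbreviation current :: "('e \<Rightarrow> int) \<Rightarrow> nat \<Rightarrow> 'v \<times> 'e \<Rightarrow> bool" where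
  "current \<equiv> current_at V E B \<rho> b0 b"

definition visits :: "('e \<Rightarrow> int) \<Rightarrow> nat \<Rightarrow> 'e \<Rightarrow> bool" where
  "visits f n e \<longleftrightarrow> (\<exists>c\<in>incident B (Inr e). current f n c)"

text \<open>Meaningful only if \<open>e\<close> is visited at least once, which
  \<open>all_visited\<close> establishes for hypertrees.\<close>

definition visit_time :: "('e \<Rightarrow> int) \<Rightarrow> 'e \<Rightarrow> nat" where
  "visit_time f e = (LEAST n. visits f n e)"

lemma good_state_at:
  assumes "f \<in> hypertrees V E B" "state_at f n = Some s"
  shows "good_state f s"
  using assms(2)
proof (induction n arbitrary: s)
  case 0
  then show ?case using good_state_init[OF assms(1) base] by simp
next
  case (Suc n)
  then obtain s0 where "state_at f n = Some s0" "bernardi_step V E \<rho> f s0 = Some s"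
    by (auto simp: bind_eq_Some_conv)
  then show ?case using Suc.IH good_state_step by blast
qed

lemma visits_unique: "visits f n e \<Longrightarrow> visits f n e' \<Longrightarrow> e = e'"
  by (auto simp: visits_def current_at_def incident_def)

lemma visits_if_not_traversed:
  assumes f: "f \<in> hypertrees V E B" and s: "state_at f n = Some (G, a, R)" and "(Inr (snd a), a) \<notin> R"
  shows "visits f n (snd a)"
proof -
  have "a \<in> B" using good_state_at[OF f s] by auto
  then show ?thesis using s assms(3) by (auto simp: visits_def current_at_def incident_def)
qed

text \<open>An edge traversed from its emerald end is forced, so it cannot be removed, and
  traversing it again would stop the process. Hence every state that has a successor counts as a
  visit.\<close>

lemma step_not_traversed:
  assumes "good_state f (G, a, R)" "bernardi_step V E \<rho> f (G, a, R) = Some s"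
  shows "(Inr (snd a), a) \<notin> R"
proof (cases "f \<in> hypertrees V E (G - {a})")
  case True
  then show ?thesis using assms(1) unfolding good_state.simps by blast
next
  case False
  then show ?thesis using assms(2) by (auto simp: bernardi_step_def)
qed

text \<open>Every step acts at the emerald end of the current edge, which is being visited. This
  turns facts about \<open>G\<close> and \<open>R\<close> into facts about visit times.\<close>

lemma trace_visits:
  assumes f: "f \<in> hypertrees V E B" and "state_at f n = Some (G, a, R)"
  shows "(\<forall>c\<in>B - G. \<exists>m<n. visits f m (snd c)) \<and> (\<forall>e c. (Inr e, c) \<in> R \<longrightarrow> (\<exists>m<n. visits f m e))"
  using assms(2)
proof (induction n arbitrary: G a R)
  case 0
  then show ?case by (auto simp: bernardi_init_def split: sum.splits)
next
  case (Suc n)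
  then obtain G0 a0 R0 where s: "state_at f n = Some (G0, a0, R0)"
    and st: "bernardi_step V E \<rho> f (G0, a0, R0) = Some (G, a, R)"
    by (auto simp: bind_eq_Some_conv)
  have v: "visits f n (snd a0)"
    using visits_if_not_traversed[OF f s] step_not_traversed[OF good_state_at[OF f s] st] by blast
  have IH: "\<forall>c\<in>B - G0. \<exists>m<n. visits f m (snd c)" "\<forall>e c. (Inr e, c) \<in> R0 \<longrightarrow> (\<exists>m<n. visits f m e)"
    using Suc.IH[OF s] by blast+
  have G: "B - G \<subseteq> insert a0 (B - G0)"
    and R: "\<And>e c. (Inr e, c) \<in> R \<Longrightarrow> (Inr e, c) \<in> R0 \<or> e = snd a0"
    using st by (auto simp: bernardi_step_def Let_def split: if_splits)
  show ?case
  proof (intro conjI ballI allI impI)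
    fix c assume "c \<in> B - G"
    then show "\<exists>m<Suc n. visits f m (snd c)" using G IH(1) v by (metis insertE lessI less_SucI subsetD)
  next
    fix e c assume "(Inr e, c) \<in> R"
    then show "\<exists>m<Suc n. visits f m e" using R IH(2) v by (metis lessI less_SucI)
  qed
qed

lemma stops:
  assumes f: "f \<in> hypertrees V E B"
  obtains n s where "state_at f n = Some s" "bernardi_step V E \<rho> f s = None"
proof -
  have "\<exists>n s. state_at f n = Some s \<and> bernardi_step V E \<rho> f s = None"
  proof (rule ccontr)
    assume n: "\<not> ?thesis"
    have some: "\<exists>s. state_at f n = Some s" for n
    proof (induction n)
      case 0
      show ?case by (rule exI) (rule bernardi_state.simps(1))
    next
      case (Suc n)
      then obtain s where s: "state_at f n = Some s" by blast
      then have "bernardi_step V E \<rho> f s \<noteq> None" using n by metis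
      then show ?case using s by (metis bernardi_state.simps(2) bind.bind_lunit not_None_eq)
    qed
    \<comment> \<open>Each step removes an edge or enlarges \<open>R\<close>, which stays within
      \<open>darts B\<close>, so the subtraction is not truncated.\<close>
    define \<mu> where "\<mu> s = (case s of (G, a, R) \<Rightarrow> card G + (card (darts B) - card R))" for s :: "('v, 'e) state"
    have dec: "\<mu> s' < \<mu> s" if "state_at f n = Some s" "state_at f (Suc n) = Some s'" for n s s'
    proof -
      obtain G a R where s: "s = (G, a, R)" by (cases s)
      obtain G' a' R' where s': "s' = (G', a', R')" by (cases s')
      have st: "bernardi_step V E \<rho> f (G, a, R) = Some (G', a', R')"
        using that by (simp add: s s')
      have g: "good_state f (G, a, R)" "good_state f (G', a', R')"
        using good_state_at[OF f] that s s' by blast+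
      have GB: "G \<subseteq> B" "G' \<subseteq> B" and a: "a \<in> G" using g by auto
      have fin: "finite G" using finite_subset[OF GB(1)] B_sub finite_edges by blast
      have "darts G' \<subseteq> darts B" using GB by (auto simp: darts_iff)
      moreover have "R' \<subseteq> darts G'" using g(2) by simp
      ultimately have R': "R' \<subseteq> darts B" by blast
      have finR: "finite R'" using R' finite_darts[of B] finite_subset by blast
      show ?thesis
      proof (cases "f \<in> hypertrees V E (G - {a})")
        case True
        then have "G' = G - {a}" "R' = R" using st by (auto simp: bernardi_step_def)
        then have "card G' < card G" using fin a by (metis card_Diff1_less)
        then show ?thesis using \<open>R' = R\<close> by (simp add: \<mu>_def s s')
      next
        case False
        then have "G' = G" "R \<subset> R'"
          using st by (auto simp: bernardi_step_def Let_def split: if_splits)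
        then have "card R < card R'" using finR by (intro psubset_card_mono)
        moreover have "card R' \<le> card (darts B)" using R' finite_darts[of B] by (intro card_mono) auto
        ultimately show ?thesis using \<open>G' = G\<close> by (simp add: \<mu>_def s s')
      qed
    qed
    have "\<mu> (the (state_at f n)) + n \<le> \<mu> (the (state_at f 0))" for n
    proof (induction n)
      case (Suc n)
      have "\<mu> (the (state_at f (Suc n))) < \<mu> (the (state_at f n))"
        using dec[of n] some[of n] some[of "Suc n"] by fastforce
      then show ?case using Suc by linarith
    qed simp
    from this[of "Suc (\<mu> (the (state_at f 0)))"] show False by simp
  qed
  then show ?thesis using that by blast
qed

text \<open>In the final graph every emerald node has an edge, whose dart is traversed or pending by
  \<open>good_state_stop\<close>; either way its hyperedge has been visited.\<close>

lemma all_visited: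
  assumes f: "f \<in> hypertrees V E B" and e: "e \<in> E"
  obtains n where "visits f n e"
proof -
  obtain n G a R where s: "state_at f n = Some (G, a, R)" and st: "bernardi_step V E \<rho> f (G, a, R) = None"
    using stops[OF f] by (metis prod_cases3)
  have g: "good_state f (G, a, R)" using good_state_at[OF f s] .
  then have "f \<in> hypertrees V E G" by simp
  then obtain c where "c \<in> incident G (Inr e)"
    using incident_nonempty[of G "Inr e"] hypertree_connected e by blast
  then have "(Inr e, c) \<in> darts G" by (simp add: darts_def)
  then have "(Inr e, c) \<in> insert (Inr (snd a), a) R" using good_state_stop[OF g st] by blast
  then consider "(Inr e, c) \<in> R" | "(Inr (snd a), a) \<notin> R" "e = snd a" by auto
  then show ?thesis
  proof cases
    case 1
    then show ?thesis using trace_visits[OF f s] that by blast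
  next
    case 2
    then show ?thesis using visits_if_not_traversed[OF f s] that by blast
  qed
qed

lemma visits_visit_time: "f \<in> hypertrees V E B \<Longrightarrow> e \<in> E \<Longrightarrow> visits f (visit_time f e) e"
  unfolding visit_time_def using all_visited by (metis LeastI)

lemma visit_time_le: "visits f n e \<Longrightarrow> visit_time f e \<le> n"
  unfolding visit_time_def by (rule Least_le)

lemma inj_visit_time: "f \<in> hypertrees V E B \<Longrightarrow> inj_on (visit_time f) E"
  by (rule inj_onI) (metis visits_visit_time visits_unique)

lemma bernardi_order_iff:
  assumes f: "f \<in> hypertrees V E B"
  shows "(e1, e2) \<in> bernardi_order V E B \<rho> b0 b f \<longleftrightarrow> e1 \<in> E \<and> e2 \<in> E \<and> visit_time f e1 < visit_time f e2"
proof -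
  have "(\<exists>n. \<exists>a\<in>incident B (Inr e1). current f n a \<and> (\<forall>m. \<forall>c\<in>incident B (Inr e2). current f m c \<longrightarrow> n < m))
      \<longleftrightarrow> (\<exists>n. visits f n e1 \<and> (\<forall>m. visits f m e2 \<longrightarrow> n < m))"
    by (auto simp: visits_def)
  also have "\<dots> \<longleftrightarrow> visit_time f e1 < visit_time f e2" if "e1 \<in> E" "e2 \<in> E"
    using visits_visit_time[OF f] visit_time_le that by (meson le_less_trans less_le_trans)
  finally show ?thesis unfolding bernardi_order_def by blast
qed

text \<open>Two hypertrees that differ by a shift outside a tight set pass the same removal tests as long
  as only hyperedges of this set have been visited.\<close>
lemma same_history:
  assumes f: "f \<in> hypertrees V E B" "shift f x y \<in> hypertrees V E B"
    and xy: "x \<in> E" "y \<in> E" "x \<noteq> y" and U: "tight B f U" "x \<notin> U" "y \<notin> U"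
    and e0: "\<And>e. e \<in> E \<Longrightarrow> visit_time f e < \<tau> \<Longrightarrow> e \<in> U"
  shows "n \<le> \<tau> \<Longrightarrow> state_at (shift f x y) n = state_at f n"
proof (induction n)
  case (Suc n)
  then have IH: "state_at (shift f x y) n = state_at f n" by simp
  show ?case
  proof (cases "state_at f n")
    case None
    then show ?thesis using IH by simp
  next
    case (Some s)
    obtain G a R where s: "s = (G, a, R)" by (cases s)
    have st: "state_at f n = Some (G, a, R)" using Some s by simp
    have g: "good_state f (G, a, R)" using good_state_at[OF f(1) st] .
    then have GB: "G \<subseteq> B" and a: "a \<in> G" by auto
    have inU: "snd c \<in> U" if "m < \<tau>" "visits f m (snd c)" "c \<in> B" for c m
    proof (rule e0)
      show "snd c \<in> E" using that(3) B_sub by auto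
      show "visit_time f (snd c) < \<tau>" using visit_time_le[OF that(2)] that(1) by (rule le_less_trans)
    qed
    \<comment> \<open>The current edge may have been traversed already, in a state where the process
      stops; then its hyperedge was visited earlier.\<close>
    have "\<exists>m\<le>n. visits f m (snd a)"
    proof (cases "(Inr (snd a), a) \<in> R")
      case True
      then show ?thesis using trace_visits[OF f(1) st] by (meson less_imp_le)
    next
      case False
      then show ?thesis using visits_if_not_traversed[OF f(1) st] by blast
    qed
    then obtain m where "m \<le> n" "visits f m (snd a)" by blast
    then have "snd a \<in> U" using inU[of m a] a GB Suc.prems by auto
    moreover have "snd c \<in> U" if c: "c \<in> B - G" for c
    proof -
      obtain m where "m < n" "visits f m (snd c)" using trace_visits[OF f(1) st] c by blast
      then show ?thesis using inU[of m c] c Suc.prems by simp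
    qed
    ultimately have "snd ` (B - (G - {a})) \<subseteq> U" by auto
    then have "shift f x y \<in> hypertrees V E (G - {a}) \<longleftrightarrow> f \<in> hypertrees V E (G - {a})"
      using GB by (intro shift_hypertree_subgraph_iff[OF B_sub f xy U]) auto
    then have "bernardi_step V E \<rho> (shift f x y) (G, a, R) = bernardi_step V E \<rho> f (G, a, R)"
      by (simp add: bernardi_step_def)
    then show ?thesis using IH st by simp
  qed
qed simp

lemma sum_bernardi:
  assumes r: "distinct r" "set r = E"
  shows "(\<Sum>f\<in>hypertrees V E B. monom (1::int) (internal_inactivity V E B (bernardi_order V E B \<rho> b0 b f) f)) =
    (\<Sum>f\<in>hypertrees V E B. monom 1 (list_inactivity B f {} r))"
proof -
  let ?H = "hypertrees V E B" and ?w = "\<lambda>f. key_list E (visit_time f)"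
  have w: "distinct (?w f)" "set (?w f) = E" "sorted_wrt (\<lambda>x y. visit_time f x < visit_time f y) (?w f)"
    if "f \<in> ?H" for f
    using key_list[OF finE inj_visit_time[OF that]] by blast+
  have "internal_inactivity V E B (bernardi_order V E B \<rho> b0 b f) f = list_inactivity B f {} (?w f)" if f: "f \<in> ?H" for f
  proof (rule internal_inactivity_eq_list_inactivity[OF B_sub f w(1,2)[OF f]])
    show "sorted_wrt (\<lambda>y x. (y, x) \<in> bernardi_order V E B \<rho> b0 b f) (?w f)"
      by (rule sorted_wrt_mono_rel[OF _ w(3)[OF f]]) (use w(2)[OF f] in \<open>simp add: bernardi_order_iff[OF f]\<close>)
  qed (simp add: bernardi_order_iff[OF f])
  moreover have "(\<Sum>f\<in>?H. monom (1::int) (list_inactivity B f {} (?w f))) = (\<Sum>f\<in>?H. monom 1 (list_inactivity B f {} r))"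
  proof (rule sum_list_inactivity_adaptive[OF B_sub _ r])
    show "distinct (?w f) \<and> set (?w f) = E" if "f \<in> ?H" for f using w[OF that] by blast
    fix f k U x y
    assume f: "f \<in> ?H" and k: "k < card E" and U: "tight B f U" "set (take k (?w f)) \<subseteq> U"
      and x: "x \<in> E - U" and y: "y \<in> E - U" and "x \<noteq> y" and g: "shift f x y \<in> ?H"
    let ?g = "shift f x y"
    define \<tau> where "\<tau> = visit_time f (?w f ! k)"
    have len: "length (?w f) = card E" using w(1,2)[OF f] distinct_card by metis
    have prefix: "e \<in> U" if e: "e \<in> E" "visit_time f e < \<tau>" for e
    proof -
      obtain i where i: "i < length (?w f)" "e = ?w f ! i" using e(1) w(2)[OF f] by (metis in_set_conv_nth)
      have "i < k"
      proof (rule ccontr)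
        assume "\<not> i < k"
        then have "\<tau> \<le> visit_time f e"
          using sorted_wrt_nth_less[OF w(3)[OF f], of k i] i unfolding \<tau>_def by (cases "i = k") auto
        then show False using e(2) by simp
      qed
      then have "e \<in> set (take k (?w f))" using i by (auto simp: in_set_conv_nth)
      then show ?thesis using U by blast
    qed
    \<comment> \<open>The states agree even at time \<open>\<tau>\<close>, although the hyperedge
      visited then need not lie in \<open>U\<close>: its first removal test comes only in the step
      after this state. Hence the next hyperedge is the same as well.\<close>
    have same: "n \<le> \<tau> \<Longrightarrow> state_at ?g n = state_at f n" for n
      using same_history[OF f g _ _ \<open>x \<noteq> y\<close> U(1) _ _ prefix] x y by blast
    have vis: "visits ?g n e = visits f n e" if "n \<le> \<tau>" for n e
      unfolding visits_def current_at_def same[OF that] ..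
    show "take (Suc k) (?w ?g) = take (Suc k) (?w f)"
    proof (rule take_key_list_eq[OF finE inj_visit_time[OF f] inj_visit_time[OF g] k \<tau>_def])
      fix e assume e: "e \<in> E" "visit_time f e \<le> \<tau> \<or> visit_time ?g e \<le> \<tau>"
      have le: "visit_time ?g e \<le> visit_time f e" if "visit_time f e \<le> \<tau>"
        using vis[OF that] visits_visit_time[OF f e(1)] by (simp add: visit_time_le)
      have ge: "visit_time f e \<le> visit_time ?g e" if "visit_time ?g e \<le> \<tau>"
        using vis[OF that] visits_visit_time[OF g e(1)] by (simp add: visit_time_le)
      show "visit_time f e = visit_time ?g e" using e(2) le ge by linarith
    qed
  qed
  ultimately show ?thesis by simp
qed

end

section \<open>Comparison with a fixed linear order\<close>

lemma linear_order_key: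
  assumes "finite E" "linear_order_on E r"
  obtains t :: "'e \<Rightarrow> nat" where "\<And>x y. x \<in> E \<Longrightarrow> y \<in> E \<Longrightarrow> t x < t y \<longleftrightarrow> (x, y) \<in> r - Id" "inj_on t E"
proof -
  have r: "trans r" "antisym r" "total_on E r" "r \<subseteq> E \<times> E"
    using assms(2) by (auto simp: linear_order_on_def partial_order_on_def preorder_on_def refl_on_def)
  define t where "t x = card {z \<in> E. (z, x) \<in> r - Id}" for x
  have lt: "t x < t y" if "x \<in> E" "y \<in> E" "(x, y) \<in> r - Id" for x y
    unfolding t_def
  proof (rule psubset_card_mono)
    show "{z \<in> E. (z, x) \<in> r - Id} \<subset> {z \<in> E. (z, y) \<in> r - Id}"
      using that r(1,2) by (auto dest: transD antisymD)
  qed (use assms in simp)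
  have "t x < t y \<longleftrightarrow> (x, y) \<in> r - Id" if "x \<in> E" "y \<in> E" for x y
    using lt[of x y] lt[of y x] that r(3) unfolding total_on_def by fastforce
  moreover have "inj_on t E"
    using lt r(3) unfolding inj_on_def total_on_def by (metis DiffI less_irrefl pair_in_Id_conv)
  ultimately show ?thesis using that by blast
qed

lemma bernardi_run_if_data:
  assumes "connected_hypergraph V E h" "bernardi_data V E h \<rho> b0 b"
  shows "bernardi_run V E (Bip E h) \<rho> b0 b"
proof
  have h: "hypergraph V E h" using assms(1) by (simp add: connected_hypergraph_def)
  then show "finite V" "finite E" by (simp_all add: hypergraph_def)
  show B: "Bip E h \<subseteq> V \<times> E" using h by (auto simp: hypergraph_def Bip_def)
  show base: "b \<in> incident (Bip E h) b0" using assms(2) by (simp add: bernardi_data_def)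
  then have "b \<in> V \<times> E" using B by (auto simp: incident_def)
  then show "V \<noteq> {}" "E \<noteq> {}" by auto
  show "ribbon_structure (V <+> E) (Bip E h) \<rho>" using assms(2) by (simp add: bernardi_data_def)
qed

lemma bernardi_polynomial_eq_interior:
  assumes "connected_hypergraph V E h" "bernardi_data V E h \<rho> b0 b" "linear_order_on E r"
  shows "bernardi_polynomial V E h \<rho> b0 b = interior_polynomial V E h r"
proof -
  interpret bernardi_run V E "Bip E h" \<rho> b0 b using bernardi_run_if_data assms by blast
  obtain t :: "_ \<Rightarrow> nat" where t: "\<And>x y. x \<in> E \<Longrightarrow> y \<in> E \<Longrightarrow> t x < t y \<longleftrightarrow> (x, y) \<in> r - Id" "inj_on t E"
    using linear_order_key[OF finE assms(3)] by blast
  \<comment> \<open>The listing of \<open>E\<close> by \<open>r\<close> is the reference list to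
    which both polynomials are reduced.\<close>
  note L = key_list[OF finE t(2)]
  have "internal_inactivity V E (Bip E h) (r - Id) f = list_inactivity (Bip E h) f {} (key_list E t)"
    if "f \<in> hypertrees V E (Bip E h)" for f
  proof (rule internal_inactivity_eq_list_inactivity[OF B_sub that L(1,2)])
    show "sorted_wrt (\<lambda>y x. (y, x) \<in> r - Id) (key_list E t)"
      by (rule sorted_wrt_mono_rel[OF _ L(3)]) (use t(1) L(2) in blast)
    have "antisym r" using assms(3) by (simp add: linear_order_on_def partial_order_on_def)
    then show "(x, y) \<in> r - Id \<Longrightarrow> (y, x) \<notin> r - Id" for x y by (auto dest: antisymD)
  qed
  then show ?thesis
    unfolding bernardi_polynomial_def interior_polynomial_def by (simp add: sum_bernardi[OF L(1,2)])
qed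

theorem theorem5p4:
  fixes V :: "'v set" and E :: "'e set" and h :: "'e \<Rightarrow> 'v set"
    and \<rho> :: "'v + 'e \<Rightarrow> 'v \<times> 'e \<Rightarrow> 'v \<times> 'e" and b0 :: "'v + 'e" and b :: "'v \<times> 'e"
    and r :: "('e \<times> 'e) set"
  assumes "connected_hypergraph V E h"
    and "bernardi_data V E h \<rho> b0 b"
    and "linear_order_on E r"
  shows "bernardi_polynomial V E h \<rho> b0 b = interior_polynomial V E h r \<and>
    (\<forall>\<rho>' b0' b'. bernardi_data V E h \<rho>' b0' b' \<longrightarrow>
       bernardi_polynomial V E h \<rho>' b0' b' = bernardi_polynomial V E h \<rho> b0 b)"
  using bernardi_polynomial_eq_interior[OF assms(1) _ assms(3)] assms(2) by simp

end
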